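(* Let $a>0$, $R>0$, let $V\in C^2([0,\infty))$ be real-valued, and let $V_{\min},V_{\max},|V'|_{\max},V''_{\min},V''_{\max}$ be real constants such that for all $x\in[0,\infty)$ $$V_{\min}\le V(x)\le V_{\max},\qquad |V'(x)|\le |V'|_{\max},\qquad V''_{\min}\le V''(x)\le V''_{\max}.$$ Let $D(A)=H^4(0,\infty)\cap H_0^2(0,\infty)$ (complex-valued functions), $X=H^2(0,\infty)\cap H^1_0(0,\infty)$, and define $A:D(A)\to L^2(0,\infty)$ and $B:X\to L^2(0,\infty)$ by $$Au=(-D^2+a^2)^2u+iaR\,[V\cdot(-D^2+a^2)u+V''\cdot u],\qquad Bu=(-D^2+a^2)u,\qquad D=\tfrac{d}{dx}.$$ Then every eigenvalue $\lambda$ of the problem $Au=\lambda Bu$ is contained in the set $$[a^2,\infty)+iaR\,[V_{\min},V_{\max}]+\tfrac{R}{2}|V'|_{\max}\cdot\Delta,$$ where $\Delta$ denotes the closed unit disc in $\mathbb{C}$.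
   Context: An eigenvalue of the problem $Au=\lambda Bu$ is a number $\lambda\in\mathbb{C}$ for which there exists $u\in D(A)$, $u\ne 0$, with $Au=\lambda Bu$. $H^1_0(0,\infty)$ and $H_0^2(0,\infty)$ are the usual Sobolev spaces with vanishing traces at $0$ ($u(0)=0$, respectively $u(0)=u'(0)=0$), and $i$ is the imaginary unit. Sums and products of sets (and of numbers with sets) are elementwise: $S+T=\{s+t: s\in S,\ t\in T\}$, $cS=\{cs: s\in S\}$. *)

theory Defs
  imports "HOL-Analysis.Analysis" "HOL-Library.Set_Algebras"
begin

text \<open>
  Elements of function spaces over the half-line are represented by functions
  \<open>real \<Rightarrow> complex\<close>, whose values outside \<open>{0<..}\<close> are irrelevant. Equality in
  \<open>L\<^sup>2(0,\<infinity>)\<close> is equality almost everywhere (\<open>ae_eq\<close>); all the spaces and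
  operators below respect it.
\<close>

abbreviation halfline :: "real measure" where
  "halfline \<equiv> lebesgue_on {0<..}"

definition ae_eq :: "(real \<Rightarrow> complex) \<Rightarrow> (real \<Rightarrow> complex) \<Rightarrow> bool" where
  "ae_eq u v \<longleftrightarrow> (AE x in halfline. u x = v x)"

definition L2 :: "(real \<Rightarrow> complex) set" where
  "L2 = {u. u \<in> borel_measurable halfline \<and> integrable halfline (\<lambda>x. (cmod (u x))\<^sup>2)}"

definition L1_loc :: "(real \<Rightarrow> complex) set" where
  "L1_loc = {u. \<forall>K. compact K \<longrightarrow> K \<subseteq> {0<..} \<longrightarrow> integrable (lebesgue_on K) u}"

text \<open>
  \<open>C\<^sub>c\<^sup>\<infinity>(0,\<infinity>)\<close>, each test function being extended by zero to the whole line. Real-valued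
  test functions determine the same weak derivatives as complex-valued ones.
\<close>

definition test_functions :: "(real \<Rightarrow> real) set" where
  "test_functions = {\<phi>.
     (\<forall>n x. (deriv ^^ n) \<phi> field_differentiable (at x)) \<and>
     (\<exists>K. compact K \<and> K \<subseteq> {0<..} \<and> (\<forall>x. x \<notin> K \<longrightarrow> \<phi> x = 0))}"

definition has_weak_deriv :: "nat \<Rightarrow> (real \<Rightarrow> complex) \<Rightarrow> (real \<Rightarrow> complex) \<Rightarrow> bool" where
  "has_weak_deriv j u v \<longleftrightarrow> u \<in> L1_loc \<and> v \<in> L1_loc \<and>
     (\<forall>\<phi>\<in>test_functions.
        integral\<^sup>L halfline (\<lambda>x. (deriv ^^ j) \<phi> x *\<^sub>R u x)
          = (- 1) ^ j * integral\<^sup>L halfline (\<lambda>x. \<phi> x *\<^sub>R v x))"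

text \<open>Weak derivatives are unique up to \<open>ae_eq\<close>; \<open>weak_deriv\<close> selects a representative.\<close>

definition weak_deriv :: "nat \<Rightarrow> (real \<Rightarrow> complex) \<Rightarrow> (real \<Rightarrow> complex)" where
  "weak_deriv j u = (SOME v. has_weak_deriv j u v)"

definition sobolev_H :: "nat \<Rightarrow> (real \<Rightarrow> complex) set" where
  "sobolev_H k = {u \<in> L2. \<forall>j\<le>k. \<exists>v\<in>L2. has_weak_deriv j u v}"

text \<open>The trace at \<open>0\<close> is the value at \<open>0\<close> of the continuous representative on \<open>[0,\<infinity>)\<close>.\<close>

definition has_trace :: "(real \<Rightarrow> complex) \<Rightarrow> complex \<Rightarrow> bool" where
  "has_trace u c \<longleftrightarrow> (\<exists>w. continuous_on {0..} w \<and> ae_eq u w \<and> w 0 = c)"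

definition H1_0 :: "(real \<Rightarrow> complex) set" where
  "H1_0 = {u \<in> sobolev_H 1. has_trace u 0}"

definition H2_0 :: "(real \<Rightarrow> complex) set" where
  "H2_0 = {u \<in> sobolev_H 2. has_trace u 0 \<and> has_trace (weak_deriv 1 u) 0}"

definition dom_A :: "(real \<Rightarrow> complex) set" where
  "dom_A = sobolev_H 4 \<inter> H2_0"

definition dom_B :: "(real \<Rightarrow> complex) set" where
  "dom_B = sobolev_H 2 \<inter> H1_0"

definition op_B :: "real \<Rightarrow> (real \<Rightarrow> complex) \<Rightarrow> (real \<Rightarrow> complex)" where
  "op_B a u = (\<lambda>x. - weak_deriv 2 u x + of_real (a\<^sup>2) * u x)"

text \<open>The argument \<open>V2\<close> is the second derivative of the potential \<open>V\<close>.\<close>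

definition op_A ::
  "real \<Rightarrow> real \<Rightarrow> (real \<Rightarrow> real) \<Rightarrow> (real \<Rightarrow> real) \<Rightarrow> (real \<Rightarrow> complex) \<Rightarrow> (real \<Rightarrow> complex)" where
  "op_A a R V V2 u = (\<lambda>x. op_B a (op_B a u) x
     + \<i> * of_real (a * R) * (of_real (V x) * op_B a u x + of_real (V2 x) * u x))"

definition is_eigenvalue ::
  "(real \<Rightarrow> complex) set \<Rightarrow> ((real \<Rightarrow> complex) \<Rightarrow> (real \<Rightarrow> complex)) \<Rightarrow>
   ((real \<Rightarrow> complex) \<Rightarrow> (real \<Rightarrow> complex)) \<Rightarrow> complex \<Rightarrow> bool" where
  "is_eigenvalue D A B \<mu> \<longleftrightarrow>
     (\<exists>u\<in>D. \<not> ae_eq u (\<lambda>x. 0) \<and> ae_eq (A u) (\<lambda>x. \<mu> * B u x))"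

text \<open>\<open>op_B\<close> is meant on \<open>dom_B\<close>; the eigenvalue problem applies it to elements of \<open>dom_A\<close>.\<close>

lemma dom_A_subset_dom_B: "dom_A \<subseteq> dom_B"
  by (auto simp: dom_A_def dom_B_def H2_0_def H1_0_def sobolev_H_def)

end

theory Submission
  imports Defs "HOL-Computational_Algebra.Polynomial"
begin

text \<open>
  Pair \<open>A u = \<mu> B u\<close> with \<open>u\<close> in \<open>L\<^sup>2\<close> and integrate by parts. The boundary conditions remove all
  boundary terms, and the terms containing \<open>V''\<close> combine with those from \<open>V u''\<close> to give
  \<open>\<mu> E = N + i a R (Q - T)\<close>, where \<open>E = \<integral> |u'|\<^sup>2 + a\<^sup>2 |u|\<^sup>2\<close>,
  \<open>N = \<integral> |u''|\<^sup>2 + 2 a\<^sup>2 |u'|\<^sup>2 + a\<^sup>4 |u|\<^sup>2\<close>, \<open>Q = \<integral> V (|u'|\<^sup>2 + a\<^sup>2 |u|\<^sup>2)\<close> and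
  \<open>T = \<integral> V' u cnj u'\<close>. Now \<open>N \<ge> a\<^sup>2 E\<close>, \<open>Q / E\<close> is an average of \<open>V\<close>, and
  \<open>2 a |T| \<le> max |V'| E\<close> by the arithmetic-geometric mean inequality.
  The integrations by parts are justified by absolutely continuous representatives of the weak
  derivatives, which the lemma of du Bois-Reymond provides.
\<close>

section \<open>Smooth cut-off functions\<close>

text \<open>No decay of \<open>u\<close> or its derivatives at infinity is proved separately. Each
  boundary expression is a product of square-integrable functions, possibly times the bounded
  \<open>V\<close> or \<open>V1\<close>, so both it and its derivative are integrable. Such a
  function has a limit at infinity, and the limit can only be 0; what remains is its value at 0.

  The obstacle is that \<open>weak_deriv\<close> merely selects some representative, and that
  \<open>op_A\<close> applies it to \<open>op_B a u\<close>, which is itself built from a selected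
  representative. All of this has to be traced back to one chain \<open>u0\<close>, ...,
  \<open>u4\<close> in which each function is the integral of the next one, so that point values at
  0 make sense.

  Since everything weak is tested against \<open>test_functions\<close>, the chain rests on explicit
  test functions that approximate indicators of intervals. These come from
  \<open>exp (- 1 / y)\<close> composed with a quadratic polynomial.

  The parameter \<open>a\<close> drops out of the radius of the disc because the factor
  \<open>a\<close> in \<open>i a R T\<close> is exactly the one that balances \<open>u\<close>
  against \<open>u'\<close> in the mean inequality.\<close>

definition smooth :: "(real \<Rightarrow> real) \<Rightarrow> bool" where
  "smooth f \<longleftrightarrow> (\<forall>n x. (deriv ^^ n) f field_differentiable (at x))"

text \<open>Coinduction replaces formulas for the n-th derivative: it suffices to exhibit a class of
  functions that is closed under differentiation.\<close>

lemma smooth_coinduct: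
  assumes "f \<in> S" "\<And>g. g \<in> S \<Longrightarrow> \<exists>h\<in>S. \<forall>x. (g has_real_derivative h x) (at x)"
  shows "smooth f"
proof -
  have step: "deriv g \<in> S" if g: "g \<in> S" for g
  proof -
    obtain h where "h \<in> S" "\<forall>x. (g has_real_derivative h x) (at x)"
      using assms(2)[OF g] by blast
    moreover from this have "deriv g = h" by (auto intro!: ext DERIV_imp_deriv)
    ultimately show ?thesis by simp
  qed
  have "(deriv ^^ n) f \<in> S" for n by (induction n) (auto simp: assms(1) step)
  with assms(2) show ?thesis unfolding smooth_def field_differentiable_def by blast
qed

lemma smooth_deriv: "smooth f \<Longrightarrow> (f has_real_derivative deriv f x) (at x)"
  unfolding smooth_def using field_differentiable_derivI[of f x] by (metis funpow_0)

lemma smooth_higher_deriv: "smooth f \<Longrightarrow> smooth ((deriv ^^ n) f)"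
  unfolding smooth_def by (metis comp_apply funpow_add)

lemma smooth_continuous_on: "smooth f \<Longrightarrow> continuous_on S f"
  by (rule DERIV_continuous_on[OF has_field_derivative_at_within[OF smooth_deriv]])

lemma higher_deriv_lincomb:
  assumes "smooth f" "smooth g"
  shows "(deriv ^^ n) (\<lambda>x. f x + c * g x) = (\<lambda>x. (deriv ^^ n) f x + c * (deriv ^^ n) g x)"
proof (induction n)
  case (Suc n)
  have "((\<lambda>x. (deriv ^^ n) f x + c * (deriv ^^ n) g x) has_real_derivative
      (deriv ^^ Suc n) f x + c * (deriv ^^ Suc n) g x) (at x)" for x
    using smooth_deriv[OF smooth_higher_deriv[OF assms(1), of n], of x]
      smooth_deriv[OF smooth_higher_deriv[OF assms(2), of n], of x]
    by (auto intro!: derivative_eq_intros)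
  then show ?case by (auto simp: Suc intro!: ext DERIV_imp_deriv)
qed simp

lemma smooth_lincomb:
  assumes "smooth f" "smooth g"
  shows "smooth (\<lambda>x. f x + c * g x)"
  unfolding smooth_def higher_deriv_lincomb[OF assms]
  using assms[unfolded smooth_def] by (auto intro!: derivative_intros)

text \<open>
  A family containing \<open>exp (- 1 / (k q))\<close> on \<open>{q > 0}\<close> that is closed under differentiation.
\<close>

definition cutoff :: "real poly \<Rightarrow> real \<Rightarrow> nat \<Rightarrow> real poly \<Rightarrow> real \<Rightarrow> real" where
  "cutoff q k j p x =
     (if poly q x > 0 then poly p x / poly q x ^ j * exp (- 1 / (k * poly q x)) else 0)"

text \<open>A single term of the power series bounds \<open>exp (1 / y)\<close> from below;
  inverting gives the claim. The free exponent \<open>m\<close> lets the exponential beat any pole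
  in \<open>cutoff\<close>.\<close>

lemma exp_neg_inverse_le:
  fixes y :: real
  assumes "y > 0"
  shows "exp (- 1 / y) \<le> fact m * y ^ m"
proof -
  have "(1 / y) ^ m /\<^sub>R fact m \<le> exp (1 / y)"
  proof -
    have "(\<Sum>n\<in>{m}. (1 / y) ^ n /\<^sub>R fact n) \<le> (\<Sum>n. (1 / y) ^ n /\<^sub>R fact n)"
      by (rule sum_le_suminf[OF summable_exp_generic]) (use assms in auto)
    then show ?thesis by (simp add: exp_def)
  qed
  then have "inverse (exp (1 / y)) \<le> inverse ((1 / y) ^ m /\<^sub>R fact m)"
    using assms by (intro le_imp_inverse_le) auto
  then show ?thesis
    using assms by (simp add: exp_minus field_simps power_one_over)
qed

text \<open>Of the \<open>j + 2\<close> powers of \<open>q\<close> gained from the exponential,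
  \<open>j\<close> cancel the pole. The remaining square makes the function differentiable, with
  derivative 0, where \<open>q\<close> vanishes.\<close>

lemma cutoff_bound:
  assumes "k > 0"
  shows "\<bar>cutoff q k j p x\<bar> \<le> \<bar>poly p x\<bar> * (fact (j + 2) * k ^ (j + 2)) * (max 0 (poly q x))\<^sup>2"
proof (cases "poly q x > 0")
  case True
  have "exp (- 1 / (k * poly q x)) \<le> fact (j + 2) * (k * poly q x) ^ (j + 2)"
    using assms True by (intro exp_neg_inverse_le) auto
  then have "\<bar>poly p x\<bar> / poly q x ^ j * exp (- 1 / (k * poly q x))
      \<le> \<bar>poly p x\<bar> / poly q x ^ j * (fact (j + 2) * (k * poly q x) ^ (j + 2))"
    using True by (intro mult_left_mono) auto
  also have "\<dots> = \<bar>poly p x\<bar> * (fact (j + 2) * k ^ (j + 2)) * (poly q x)\<^sup>2"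
    using True by (simp add: power_mult_distrib power_add power2_eq_square del: fact_Suc)
  finally show ?thesis using True by (simp add: cutoff_def abs_mult)
qed (simp add: cutoff_def)

text \<open>Where \<open>q\<close> is positive this is the product rule over the common denominator
  \<open>q ^ (j + 2)\<close>. Elsewhere the value is 0, and the quadratic bound forces the
  difference quotient to 0.\<close>

lemma cutoff_deriv:
  assumes k: "k > 0"
  shows "(cutoff q k j p has_real_derivative
     cutoff q k (j + 2) (pderiv p * q\<^sup>2 - smult (of_nat j) (p * pderiv q * q)
       + smult (1 / k) (p * pderiv q)) x) (at x)"
proof (cases "poly q x > 0")
  case True
  have ev: "eventually (\<lambda>y. poly q y > 0) (nhds x)"
    using True by (intro order_tendstoD(1)[OF isCont_tendsto_compose[of x "poly q" "\<lambda>y. y"]])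
      (auto simp: filterlim_ident)
  have "((\<lambda>y. poly p y / poly q y ^ j * exp (- 1 / (k * poly q y))) has_real_derivative
     cutoff q k (j + 2) (pderiv p * q\<^sup>2 - smult (of_nat j) (p * pderiv q * q)
       + smult (1 / k) (p * pderiv q)) x) (at x)"
  \<comment> \<open>Differentiating \<open>poly q y ^ j\<close> produces the truncated exponent
    \<open>j - 1\<close>, so \<open>j = 0\<close> is treated apart.\<close>
  proof (cases j)
    case 0
    show ?thesis unfolding 0
      using True k
      by (auto intro!: derivative_eq_intros simp: cutoff_def field_simps power2_eq_square)
  next
    case (Suc i)
    show ?thesis unfolding Suc
      using True k
      by (auto intro!: derivative_eq_intros simp: cutoff_def divide_simps power2_eq_square)
        (cases i; simp add: algebra_simps)
  qed
  then show ?thesis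
    by (rule DERIV_cong_ev[THEN iffD1, rotated -1])
      (use ev in \<open>auto elim!: eventually_mono simp: cutoff_def\<close>)
next
  case False
  define C where "C = fact (j + 2) * k ^ (j + 2)"
  have "(\<lambda>y. (poly q y - poly q x) / (y - x)) \<midarrow>x\<rightarrow> poly (pderiv q) x"
    using poly_DERIV[of q x] by (simp add: has_field_derivative_iff)
  then have "(\<lambda>y. (\<bar>poly p y\<bar> * C * \<bar>poly q y - poly q x\<bar>) * \<bar>(poly q y - poly q x) / (y - x)\<bar>)
     \<midarrow>x\<rightarrow> (\<bar>poly p x\<bar> * C * \<bar>poly q x - poly q x\<bar>) * \<bar>poly (pderiv q) x\<bar>"
    by (intro tendsto_intros poly_isCont[THEN isContD]) auto
  then have lim: "(\<lambda>y. (\<bar>poly p y\<bar> * C * \<bar>poly q y - poly q x\<bar>) * \<bar>(poly q y - poly q x) / (y - x)\<bar>)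
     \<midarrow>x\<rightarrow> 0" by simp
  \<comment> \<open>Valid for \<open>y = x\<close> as well, where both quotients are 0 by the
    convention for division by 0.\<close>
  have le: "norm ((cutoff q k j p y - cutoff q k j p x) / (y - x))
      \<le> (\<bar>poly p y\<bar> * C * \<bar>poly q y - poly q x\<bar>) * \<bar>(poly q y - poly q x) / (y - x)\<bar>" for y
  proof -
    have "\<bar>cutoff q k j p y\<bar> \<le> \<bar>poly p y\<bar> * C * (max 0 (poly q y))\<^sup>2"
      unfolding C_def by (rule cutoff_bound[OF k])
    \<comment> \<open>As \<open>poly q x\<close> is at most 0, the positive part of
      \<open>poly q y\<close> is at most the increment of \<open>q\<close>. One factor of the square
      goes into the difference quotient of \<open>q\<close>, the other tends to 0.\<close>
    also have "\<dots> \<le> \<bar>poly p y\<bar> * C * \<bar>poly q y - poly q x\<bar>\<^sup>2"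
      using False k by (intro mult_left_mono power_mono) (auto simp: C_def)
    finally have "\<bar>cutoff q k j p y\<bar> / \<bar>y - x\<bar> \<le> \<bar>poly p y\<bar> * C * \<bar>poly q y - poly q x\<bar>\<^sup>2 / \<bar>y - x\<bar>"
      by (rule divide_right_mono) simp
    moreover have "cutoff q k j p x = 0" using False by (simp add: cutoff_def)
    ultimately show ?thesis by (simp only: diff_zero norm_divide real_norm_def abs_divide
          power2_eq_square times_divide_eq_right mult.assoc)
  qed
  have "(\<lambda>y. (cutoff q k j p y - cutoff q k j p x) / (y - x)) \<midarrow>x\<rightarrow> 0"
    by (rule Lim_null_comparison[OF always_eventually[OF allI[OF le]] lim])
  then show ?thesis using False by (simp add: has_field_derivative_iff cutoff_def)
qed

lemma smooth_cutoff:
  assumes "k > 0"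
  shows "smooth (cutoff q k j p)"
  by (rule smooth_coinduct[where S = "range (\<lambda>(j, p). cutoff q k j p)"])
    (use cutoff_deriv[OF assms] in \<open>force+\<close>)

section \<open>Test functions: supports in intervals, closure properties, bumps\<close>

lemma test_functions_iff:
  "\<phi> \<in> test_functions \<longleftrightarrow> smooth \<phi> \<and> (\<exists>c d. 0 < c \<and> c < d \<and> (\<forall>x. x \<notin> {c..d} \<longrightarrow> \<phi> x = 0))"
    (is "_ = (_ \<and> ?R)")
proof -
  have "?R \<longleftrightarrow> (\<exists>K. compact K \<and> K \<subseteq> {0<..} \<and> (\<forall>x. x \<notin> K \<longrightarrow> \<phi> x = 0))" (is "_ = ?L")
  proof
    assume ?R
    then obtain c d where "0 < c" "\<forall>x. x \<notin> {c..d} \<longrightarrow> \<phi> x = 0" by blast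
    then show ?L by (intro exI[of _ "{c..d}"]) auto
  next
    assume ?L
    then obtain K where K: "compact K" "K \<subseteq> {0<..}" "\<forall>x. x \<notin> K \<longrightarrow> \<phi> x = 0" by blast
    show ?R
    proof (cases "K = {}")
      case True
      then show ?thesis using K by (intro exI[of _ 1] exI[of _ 2]) auto
    next
      case False
      obtain c where c: "c \<in> K" "\<forall>x\<in>K. c \<le> x" using compact_attains_inf[OF K(1) False] by blast
      obtain d where d: "d \<in> K" "\<forall>x\<in>K. x \<le> d" using compact_attains_sup[OF K(1) False] by blast
      \<comment> \<open>The right end is enlarged by 1 because \<open>K\<close> may be a single
        point, while \<open>c < d\<close> is demanded strictly.\<close>
      have "\<phi> x = 0" if "x \<notin> {c..d + 1}" for x
      proof -
        have "x \<notin> K" using that c(2) d(2) by (metis add_increasing2 atLeastAtMost_iff zero_le_one)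
        then show ?thesis using K(3) by blast
      qed
      moreover have "0 < c" using K(2) c(1) by auto
      moreover have "c < d + 1" using c(1) d(2) by fastforce
      ultimately show ?thesis by blast
    qed
  qed
  then show ?thesis unfolding test_functions_def smooth_def by simp
qed

lemma test_supportE:
  assumes "\<phi> \<in> test_functions"
  obtains c d where "0 < c" "c < d" "\<And>x. x \<notin> {c..d} \<Longrightarrow> \<phi> x = 0"
  using assms unfolding test_functions_iff by blast

lemma test_smooth: "\<phi> \<in> test_functions \<Longrightarrow> smooth \<phi>"
  by (simp add: test_functions_iff)

lemma test_higher_deriv:
  assumes "\<phi> \<in> test_functions"
  shows "(deriv ^^ n) \<phi> \<in> test_functions"
proof -
  obtain c d where cd: "0 < c" "c < d" "\<And>x. x \<notin> {c..d} \<Longrightarrow> \<phi> x = 0"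
    using test_supportE[OF assms] by blast
  have "(deriv ^^ n) \<phi> x = 0" if "x \<notin> {c..d}" for x
    using that
  proof (induction n arbitrary: x)
    case (Suc n)
    have "eventually (\<lambda>y. y \<in> - {c..d}) (nhds x)"
      using Suc.prems by (intro eventually_nhds_in_open) auto
    then have "eventually (\<lambda>y. (deriv ^^ n) \<phi> y = 0) (nhds x)"
      by (rule eventually_mono) (use Suc.IH in auto)
    then have "deriv ((deriv ^^ n) \<phi>) x = deriv (\<lambda>_. 0) x"
      by (rule deriv_cong_ev) simp
    then show ?case by simp
  qed (use cd in auto)
  then show ?thesis
    using cd smooth_higher_deriv[OF test_smooth[OF assms]] unfolding test_functions_iff by blast
qed

lemma test_deriv: "\<phi> \<in> test_functions \<Longrightarrow> deriv \<phi> \<in> test_functions"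
  using test_higher_deriv[of \<phi> 1] by simp

lemma test_lincomb:
  assumes "\<phi> \<in> test_functions" "\<psi> \<in> test_functions"
  shows "(\<lambda>x. \<phi> x + c * \<psi> x) \<in> test_functions"
proof -
  obtain a b where ab: "0 < a" "a < b" "\<And>x. x \<notin> {a..b} \<Longrightarrow> \<phi> x = 0"
    using test_supportE[OF assms(1)] by blast
  obtain a' b' where ab': "0 < a'" "a' < b'" "\<And>x. x \<notin> {a'..b'} \<Longrightarrow> \<psi> x = 0"
    using test_supportE[OF assms(2)] by blast
  have "0 < min a a'" "min a a' < max b b'"
    using ab(1,2) ab'(1,2) by auto
  moreover have "\<forall>x. x \<notin> {min a a'..max b b'} \<longrightarrow> \<phi> x + c * \<psi> x = 0"
  proof (intro allI impI)
    fix x assume "x \<notin> {min a a'..max b b'}"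
    then have "x \<notin> {a..b}" "x \<notin> {a'..b'}" by auto
    then show "\<phi> x + c * \<psi> x = 0" using ab(3) ab'(3) by simp
  qed
  ultimately show ?thesis
    using smooth_lincomb[OF assms[THEN test_smooth]] unfolding test_functions_iff by blast
qed

text \<open>The quadratic is \<open>(x - c) * (d - x)\<close>, positive exactly on the open
  interval. The growing factor \<open>Suc n\<close> flattens the exponential, so the bumps converge
  to the indicator of that interval while staying below 1.\<close>

definition bump :: "real \<Rightarrow> real \<Rightarrow> nat \<Rightarrow> real \<Rightarrow> real" where
  "bump c d n = cutoff [:- (c * d), c + d, - 1:] (real (Suc n)) 0 1"

lemma bump_altdef:
  "bump c d n x = (if (x - c) * (d - x) > 0 then exp (- 1 / (real (Suc n) * ((x - c) * (d - x)))) else 0)"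
proof -
  have "poly [:- (c * d), c + d, - 1:] x = (x - c) * (d - x)" by (simp add: algebra_simps)
  then show ?thesis by (simp only: bump_def cutoff_def) simp
qed

lemma bump_test:
  assumes "0 < c" "c < d"
  shows "bump c d n \<in> test_functions"
proof -
  have "bump c d n x = 0" if "x \<notin> {c..d}" for x
    using that assms by (auto simp: bump_altdef zero_less_mult_iff)
  then show ?thesis
    using assms smooth_cutoff unfolding test_functions_iff bump_def by force
qed

lemma bump_nonneg: "bump c d n x \<ge> 0"
  by (simp add: bump_altdef)

lemma bump_le_1: "bump c d n x \<le> 1"
  by (simp add: bump_altdef)

lemma bump_eq_0: "c < d \<Longrightarrow> x \<notin> {c<..<d} \<Longrightarrow> bump c d n x = 0"
  by (auto simp: bump_altdef zero_less_mult_iff)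

lemma bump_tendsto:
  assumes "c < d"
  shows "(\<lambda>n. bump c d n x) \<longlonglongrightarrow> indicator {c<..<d} x"
proof (cases "x \<in> {c<..<d}")
  case True
  define y where "y = (x - c) * (d - x)"
  have "y > 0" using True by (simp add: y_def)
  have "(\<lambda>n. (- 1 / y) * (1 / real (Suc n))) \<longlonglongrightarrow> (- 1 / y) * 0"
    by (intro tendsto_mult tendsto_const LIMSEQ_Suc[OF lim_1_over_n])
  then have "(\<lambda>n. exp ((- 1 / y) * (1 / real (Suc n)))) \<longlonglongrightarrow> exp 0"
    by (intro tendsto_intros) simp
  moreover have "bump c d n x = exp ((- 1 / y) * (1 / real (Suc n)))" for n
    using \<open>y > 0\<close> unfolding bump_altdef y_def[symmetric] by (simp add: mult.commute)
  ultimately show ?thesis using True by simp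
next
  case False
  then show ?thesis using bump_eq_0[OF assms] by simp
qed

section \<open>Absolutely continuous functions on the half-line\<close>

lemma set_integrable_halfline_iff:
  fixes f :: "real \<Rightarrow> 'b::euclidean_space"
  shows "set_integrable halfline A f \<longleftrightarrow> f absolutely_integrable_on ({0<..} \<inter> A)"
  unfolding set_integrable_def
  by (subst integrable_restrict_space) (simp_all add: indicator_inter_arith)

lemma set_integral_halfline_eq:
  fixes f :: "real \<Rightarrow> 'b::euclidean_space"
  assumes "f absolutely_integrable_on ({0<..} \<inter> A)"
  shows "(LINT x:A|halfline. f x) = integral ({0<..} \<inter> A) f"
  unfolding set_lebesgue_integral_eq_integral(2)[OF assms, symmetric]
  unfolding set_lebesgue_integral_def
  by (subst integral_restrict_space) (simp_all add: indicator_inter_arith)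

text \<open>Within the half-line \<open>{..x}\<close> is the interval from 0 to \<open>x\<close>
  without 0, and one endpoint is negligible. This gives access to the fundamental theorem of
  calculus, which is phrased for the gauge integral on closed intervals.\<close>

lemma halfline_Iic_iff:
  fixes f :: "real \<Rightarrow> 'b::euclidean_space"
  shows "set_integrable halfline {..x} f \<longleftrightarrow> f absolutely_integrable_on {0..x}"
  unfolding set_integrable_halfline_iff
  by (rule absolutely_integrable_spike_set_eq; rule negligible_subset[of "{0}"]) auto

lemma halfline_Iic_integral:
  fixes f :: "real \<Rightarrow> 'b::euclidean_space"
  assumes "set_integrable halfline {..x} f"
  shows "(LINT t:{..x}|halfline. f t) = integral {0..x} f"
  using assms unfolding set_integrable_halfline_iff
  by (subst set_integral_halfline_eq, simp)
    (rule integral_spike_set; rule negligible_subset[of "{0}"]; auto)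

lemma borel_measurable_halfline_continuous:
  fixes f :: "real \<Rightarrow> 'b::euclidean_space"
  shows "continuous_on {0..} f \<Longrightarrow> f \<in> borel_measurable halfline"
  by (rule continuous_imp_measurable_on_sets_lebesgue) (auto intro: continuous_on_subset)

lemma emeasure_halfline_Ioc:
  assumes "0 \<le> c" "c \<le> d"
  shows "emeasure halfline {c<..d} = ennreal (d - c)"
  using assms by (subst emeasure_restrict_space) auto

lemma sets_halfline_Ioc: "0 \<le> c \<Longrightarrow> {c<..d} \<in> sets halfline"
  by (subst sets_restrict_space_iff) auto

lemma sigma_finite_halfline: "sigma_finite_measure halfline"
proof (rule sigma_finite_measure.intro, intro exI conjI)
  show "countable (range (\<lambda>n. {0<..real n}))" by simp
  show "range (\<lambda>n. {0<..real n}) \<subseteq> sets halfline"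
    using sets_halfline_Ioc by blast
  show "\<Union> (range (\<lambda>n. {0<..real n})) = space halfline"
    using real_arch_simple by fastforce
  show "\<forall>a\<in>range (\<lambda>n. {0<..real n}). emeasure halfline a \<noteq> \<infinity>"
    by (auto simp: emeasure_halfline_Ioc)
qed

lemma id_measurable_halfline [measurable]: "(\<lambda>x. x) \<in> borel_measurable halfline"
  using id_borel_measurable_lebesgue_on[of "{0<..}"] by (simp add: id_def)

lemma AE_halfline_iff: "(AE x in halfline. P x) \<longleftrightarrow> (AE x in lebesgue. x > 0 \<longrightarrow> P x)"
  by (subst AE_restrict_space_iff) auto

lemma AE_halfline_neq: "AE x in halfline. x \<noteq> (c::real)"
proof -
  have "AE x in lebesgue. x \<noteq> c"
    by (rule AE_completion) (rule AE_lborel_singleton)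
  then show ?thesis unfolding AE_halfline_iff by eventually_elim simp
qed

text \<open>Stronger than \<open>L1_loc\<close>: integrability extends down to the endpoint 0, which
  is what gives primitives a value there.\<close>

definition locint :: "(real \<Rightarrow> complex) \<Rightarrow> bool" where
  "locint f \<longleftrightarrow> (\<forall>x. set_integrable halfline {..x} f)"

text \<open>This encodes local absolute continuity of \<open>F\<close> on the closed half-line with
  derivative \<open>f\<close> almost everywhere. The integral form needs no pointwise
  differentiability, and \<open>F 0\<close> stays free so that it can carry the boundary
  value.\<close>

definition primitive :: "(real \<Rightarrow> complex) \<Rightarrow> (real \<Rightarrow> complex) \<Rightarrow> bool" where
  "primitive f F \<longleftrightarrow> locint f \<and> (\<forall>x\<ge>0. F x - F 0 = (LINT t:{..x}|halfline. f t))"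

lemma locint_measurable:
  assumes "locint f"
  shows "f \<in> borel_measurable halfline"
proof (rule borel_measurable_LIMSEQ_metric)
  show "(\<lambda>x. indicator {..real n} x *\<^sub>R f x) \<in> borel_measurable halfline" for n
    using assms unfolding locint_def set_integrable_def by (blast intro: borel_measurable_integrable)
  show "(\<lambda>n. indicator {..real n} x *\<^sub>R f x) \<longlonglongrightarrow> f x" for x
  proof (rule tendsto_eventually)
    obtain N :: nat where "x \<le> real N" using real_arch_simple by blast
    then show "\<forall>\<^sub>F n in sequentially. indicator {..real n} x *\<^sub>R f x = f x"
      by (intro eventually_sequentiallyI[of N]) (auto simp: indicator_def)
  qed
qed

text \<open>The constant may depend on \<open>x\<close>; this suits products with a function that is
  bounded only on bounded intervals.\<close>

lemma locintI_bounded: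
  assumes f: "locint f" and g: "g \<in> borel_measurable halfline"
    and b: "\<And>x. \<exists>C. \<forall>t. 0 < t \<longrightarrow> t \<le> x \<longrightarrow> cmod (g t) \<le> C * cmod (f t)"
  shows "locint g"
  unfolding locint_def
proof
  fix x
  obtain C where C: "\<And>t. 0 < t \<Longrightarrow> t \<le> x \<Longrightarrow> cmod (g t) \<le> C * cmod (f t)" using b by blast
  have "integrable halfline (\<lambda>t. C *\<^sub>R (indicator {..x} t *\<^sub>R f t))"
    using f unfolding locint_def set_integrable_def by (intro integrable_scaleR_right) auto
  then show "set_integrable halfline {..x} g"
    unfolding set_integrable_def
  proof (rule Bochner_Integration.integrable_bound)
    show "(\<lambda>t. indicat_real {..x} t *\<^sub>R g t) \<in> borel_measurable halfline"
      using g by measurable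
    show "AE t in halfline. norm (indicat_real {..x} t *\<^sub>R g t)
        \<le> norm (C *\<^sub>R (indicator {..x} t *\<^sub>R f t))"
      by (intro AE_I2) (use C in \<open>force simp: indicator_def intro: order_trans[OF _ mult_right_mono]\<close>)
  qed
qed

section \<open>Calculus of primitives\<close>

lemma primitive_integral:
  assumes "primitive f F" "0 \<le> x"
  shows "f absolutely_integrable_on {0..x}" "F x = F 0 + integral {0..x} f"
proof -
  have *: "set_integrable halfline {..x} f" using assms by (simp add: primitive_def locint_def)
  then show "f absolutely_integrable_on {0..x}" by (simp only: halfline_Iic_iff)
  have "F x - F 0 = integral {0..x} f"
    using assms unfolding halfline_Iic_integral[OF *, symmetric] primitive_def by blast
  then show "F x = F 0 + integral {0..x} f" by (simp add: diff_eq_eq add.commute)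
qed

lemma primitive_continuous_on:
  assumes "primitive f F"
  shows "continuous_on {0..} F"
proof -
  have "continuous_on {0..b} F" for b
  proof (cases "b \<ge> 0")
    case True
    have "continuous_on {0..b} (\<lambda>x. F 0 + integral {0..x} f)"
      using primitive_integral(1)[OF assms True] set_lebesgue_integral_eq_integral(1)
      by (intro continuous_intros indefinite_integral_continuous_1) auto
    moreover have "F 0 + integral {0..x} f = F x" if "x \<in> {0..b}" for x
      using primitive_integral(2)[OF assms, of x] that by auto
    ultimately show ?thesis by (rule continuous_on_eq)
  qed auto
  show ?thesis
    unfolding continuous_on_eq_continuous_within
  proof
    fix x :: real assume "x \<in> {0..}"
    have "continuous (at x within {0..x + 1}) F"
      using \<open>continuous_on {0..x + 1} F\<close> \<open>x \<in> {0..}\<close> by (simp add: continuous_on_eq_continuous_within)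
    moreover have "at x within {0..x + 1} = at x within {0..}"
      by (rule at_within_nhd[of _ "{..<x + 1}"]) auto
    ultimately show "continuous (at x within {0..}) F" by simp
  qed
qed

lemma primitive_measurable: "primitive f F \<Longrightarrow> F \<in> borel_measurable halfline"
  by (intro borel_measurable_halfline_continuous primitive_continuous_on)

lemma primitive_bounded:
  assumes "primitive f F"
  obtains C where "\<And>t. 0 \<le> t \<Longrightarrow> t \<le> x \<Longrightarrow> cmod (F t) \<le> C"
proof -
  have "compact (F ` {0..x})"
    using primitive_continuous_on[OF assms] by (intro compact_continuous_image) (auto intro: continuous_on_subset)
  then have "bounded (F ` {0..x})" by (rule compact_imp_bounded)
  then show ?thesis using that unfolding bounded_iff by fastforce
qed

lemma primitiveI_C1:
  assumes "\<And>x. x \<ge> 0 \<Longrightarrow> (F has_vector_derivative f x) (at x within {0..})"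
    and "continuous_on {0..} f"
  shows "primitive f F"
proof -
  have ai: "set_integrable halfline {..x} f" for x
    unfolding halfline_Iic_iff
    by (rule absolutely_integrable_continuous_real) (use assms(2) in \<open>auto intro: continuous_on_subset\<close>)
  have "(f has_integral F x - F 0) {0..x}" if "x \<ge> 0" for x
    using that by (intro fundamental_theorem_of_calculus)
      (auto intro: has_vector_derivative_within_subset[OF assms(1)])
  from integral_unique[OF this]
  have "F x - F 0 = (LINT t:{..x}|halfline. f t)" if "x \<ge> 0" for x
    unfolding halfline_Iic_integral[OF ai] using that by simp
  then show ?thesis using ai by (auto simp: primitive_def locint_def)
qed

text \<open>Integration commutes with bounded real-linear maps. Real linearity suffices, so complex
  conjugation is covered.\<close>

lemma primitive_bounded_linear:
  assumes "primitive f F" "bounded_linear h"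
  shows "primitive (\<lambda>x. h (f x)) (\<lambda>x. h (F x))"
proof -
  interpret h: bounded_linear h by fact
  have eq: "indicator A x *\<^sub>R h y = h (indicator A x *\<^sub>R y)" for A and x :: real and y
    by (simp add: h.scaleR)
  show ?thesis
    using assms(1) unfolding primitive_def locint_def set_integrable_def set_lebesgue_integral_def eq
    by (simp add: integrable_bounded_linear[OF h.bounded_linear_axioms] integral_bounded_linear[OF h.bounded_linear_axioms] h.diff[symmetric])
qed

lemma primitive_add:
  assumes "primitive f F" "primitive g G"
  shows "primitive (\<lambda>x. f x + g x) (\<lambda>x. F x + G x)"
  unfolding primitive_def locint_def
proof (intro conjI allI impI)
  show "set_integrable halfline {..x} (\<lambda>x. f x + g x)" for x
    using assms by (intro set_integral_add) (auto simp: primitive_def locint_def)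
  fix x :: real assume "x \<ge> 0"
  then have *: "F x - F 0 = (LINT t:{..x}|halfline. f t)" "G x - G 0 = (LINT t:{..x}|halfline. g t)"
    using assms unfolding primitive_def by blast+
  have "(LINT t:{..x}|halfline. f t + g t) = (LINT t:{..x}|halfline. f t) + (LINT t:{..x}|halfline. g t)"
    using assms by (intro set_integral_add) (auto simp: primitive_def locint_def)
  then show "F x + G x - (F 0 + G 0) = (LINT t:{..x}|halfline. f t + g t)"
    unfolding *[symmetric] by simp
qed

lemma primitive_const: "primitive (\<lambda>_. 0) (\<lambda>_. c)"
  by (simp add: primitive_def locint_def set_integrable_def set_lebesgue_integral_def)

lemma primitive_diff:
  assumes "primitive f F" "primitive g G"
  shows "primitive (\<lambda>x. f x - g x) (\<lambda>x. F x - G x)"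
  using primitive_add[OF assms(1) primitive_bounded_linear[OF assms(2) bounded_linear_minus[OF bounded_linear_ident]]]
  by simp

lemma primitive_cnj: "primitive f F \<Longrightarrow> primitive (\<lambda>x. cnj (f x)) (\<lambda>x. cnj (F x))"
  by (rule primitive_bounded_linear[OF _ bounded_linear_cnj])

text \<open>Allows a selected weak derivative to be exchanged for its continuous representative, so
  that consecutive primitives link into a chain.\<close>

lemma primitive_cong_AE:
  assumes "primitive f F" "AE x in halfline. f x = g x" "g \<in> borel_measurable halfline"
  shows "primitive g F"
proof -
  have ae: "AE t in halfline. indicat_real {..x} t *\<^sub>R f t = indicator {..x} t *\<^sub>R g t" for x
    using assms(2) by eventually_elim simp
  have f: "f \<in> borel_measurable halfline"
    using assms(1) locint_measurable by (simp add: primitive_def)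
  have "set_integrable halfline {..x} f \<longleftrightarrow> set_integrable halfline {..x} g" for x
    unfolding set_integrable_def
    by (rule integrable_cong_AE[OF _ _ ae]) (use f assms(3) in measurable)
  moreover have "(LINT t:{..x}|halfline. f t) = (LINT t:{..x}|halfline. g t)" for x
    unfolding set_lebesgue_integral_def
    by (rule integral_cong_AE[OF _ _ ae]) (use f assms(3) in measurable)
  ultimately show ?thesis using assms(1) unfolding primitive_def locint_def by simp
qed

lemma integrable_pair_mult:
  fixes f g :: "'a \<Rightarrow> complex"
  assumes "sigma_finite_measure M" "integrable M f" "integrable M g"
  shows "integrable (M \<Otimes>\<^sub>M M) (\<lambda>(s, t). f s * g t)"
proof -
  interpret sigma_finite_measure M by fact
  interpret pair_sigma_finite M M ..
  have [measurable]: "f \<in> borel_measurable M" "g \<in> borel_measurable M" using assms by auto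
  show ?thesis
    by (rule Fubini_integrable) (use assms in \<open>auto simp: norm_mult\<close>)
qed

text \<open>Fubini: split the square \<open>(0, x]\<^sup>2\<close> along the diagonal.\<close>

lemma primitive_mult:
  assumes F: "primitive f F" and G: "primitive g G"
  shows "primitive (\<lambda>x. f x * G x + F x * g x) (\<lambda>x. F x * G x)"
proof -
  have fm[measurable]: "f \<in> borel_measurable halfline" and gm[measurable]: "g \<in> borel_measurable halfline"
    using F G locint_measurable by (auto simp: primitive_def)
  have Fm[measurable]: "F \<in> borel_measurable halfline" and Gm[measurable]: "G \<in> borel_measurable halfline"
    using F G primitive_measurable by auto
  have l1: "locint (\<lambda>x. f x * G x)"
  proof (rule locintI_bounded)
    show "locint f" using F by (simp add: primitive_def)
    show "(\<lambda>x. f x * G x) \<in> borel_measurable halfline" by measurable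
    fix x
    obtain C where "\<And>t. 0 \<le> t \<Longrightarrow> t \<le> x \<Longrightarrow> cmod (G t) \<le> C" using primitive_bounded[OF G] by blast
    then show "\<exists>C. \<forall>t>0. t \<le> x \<longrightarrow> cmod (f t * G t) \<le> C * cmod (f t)"
      by (intro exI[of _ C]) (simp add: norm_mult mult.commute[of C] mult_left_mono)
  qed
  have l2: "locint (\<lambda>x. F x * g x)"
  proof (rule locintI_bounded)
    show "locint g" using G by (simp add: primitive_def)
    show "(\<lambda>x. F x * g x) \<in> borel_measurable halfline" by measurable
    fix x
    obtain C where "\<And>t. 0 \<le> t \<Longrightarrow> t \<le> x \<Longrightarrow> cmod (F t) \<le> C" using primitive_bounded[OF F] by blast
    then show "\<exists>C. \<forall>t>0. t \<le> x \<longrightarrow> cmod (F t * g t) \<le> C * cmod (g t)"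
      by (intro exI[of _ C]) (simp add: norm_mult mult_right_mono)
  qed
  have li: "locint (\<lambda>x. f x * G x + F x * g x)"
    using l1 l2 by (auto simp: locint_def intro!: set_integral_add)
  interpret sigma_finite_measure halfline by (rule sigma_finite_halfline)
  interpret pair_sigma_finite halfline halfline ..
  show ?thesis
    unfolding primitive_def
  proof (intro conjI li allI impI)
    fix x :: real assume x: "x \<ge> 0"
    \<comment> \<open>Truncation at \<open>x\<close> turns integrals over the square into integrals
      over the full product space.\<close>
    define f' where "f' t = indicator {..x} t *\<^sub>R f t" for t
    define g' where "g' t = indicator {..x} t *\<^sub>R g t" for t
    have fi: "integrable halfline f'" and gi: "integrable halfline g'"
      using F G unfolding f'_def[abs_def] g'_def[abs_def]
      by (simp_all add: primitive_def locint_def set_integrable_def)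
    have [measurable]: "f' \<in> borel_measurable halfline" "g' \<in> borel_measurable halfline"
      using fi gi by auto
    have Fe: "(LINT t|halfline. indicator {..y} t *\<^sub>R f' t) = F y - F 0" if "0 \<le> y" "y \<le> x" for y
    proof -
      have "indicat_real {..y} t *\<^sub>R f' t = indicator {..y} t *\<^sub>R f t" for t
        using that by (auto simp: f'_def indicator_def)
      then have "(LINT t|halfline. indicator {..y} t *\<^sub>R f' t) = (LINT t:{..y}|halfline. f t)"
        unfolding set_lebesgue_integral_def by (simp only:)
      then show ?thesis using F that by (simp add: primitive_def)
    qed
    \<comment> \<open>One triangle contains the diagonal, hence the other must be strict for the two
      to partition the square. A single point is null, so the strict inequality does not change the
      inner integral.\<close>
    have Ge: "(LINT t|halfline. indicator {..<y} t *\<^sub>R g' t) = G y - G 0" if "0 \<le> y" "y \<le> x" for y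
    proof -
      have "(LINT t|halfline. indicat_real {..<y} t *\<^sub>R g' t) = (LINT t|halfline. indicator {..y} t *\<^sub>R g t)"
      proof (rule integral_cong_AE)
        show "AE t in halfline. indicat_real {..<y} t *\<^sub>R g' t = indicator {..y} t *\<^sub>R g t"
          using AE_halfline_neq[of y] by eventually_elim (use that in \<open>auto simp: g'_def indicator_def\<close>)
      qed measurable
      then show ?thesis using G that by (simp add: primitive_def set_lebesgue_integral_def)
    qed
    have Ix: "(LINT t|halfline. f' t) = F x - F 0" "(LINT t|halfline. g' t) = G x - G 0"
      using F G x by (simp_all add: primitive_def f'_def g'_def set_lebesgue_integral_def)
    have int: "integrable (halfline \<Otimes>\<^sub>M halfline) (\<lambda>(s, t). f' s * g' t)"
      by (rule integrable_pair_mult[OF sigma_finite_halfline fi gi])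
    have int1: "integrable (halfline \<Otimes>\<^sub>M halfline) (\<lambda>(s, t). indicat_real {..t} s *\<^sub>R (f' s * g' t))"
      by (rule Bochner_Integration.integrable_bound[OF int])
        (auto simp: indicator_def split_beta)
    have int2: "integrable (halfline \<Otimes>\<^sub>M halfline) (\<lambda>(s, t). indicat_real {..<s} t *\<^sub>R (f' s * g' t))"
      by (rule Bochner_Integration.integrable_bound[OF int])
        (auto simp: indicator_def split_beta)
    have "(F x - F 0) * (G x - G 0) = integral\<^sup>L (halfline \<Otimes>\<^sub>M halfline) (\<lambda>(s, t). f' s * g' t)"
      using integral_fst[OF int] by (simp add: Ix)
    also have "\<dots> = integral\<^sup>L (halfline \<Otimes>\<^sub>M halfline)
        (\<lambda>z. (case z of (s, t) \<Rightarrow> indicat_real {..t} s *\<^sub>R (f' s * g' t))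
           + (case z of (s, t) \<Rightarrow> indicat_real {..<s} t *\<^sub>R (f' s * g' t)))"
      by (intro Bochner_Integration.integral_cong) (auto simp: indicator_def)
    also have "\<dots> = integral\<^sup>L (halfline \<Otimes>\<^sub>M halfline) (\<lambda>(s, t). indicat_real {..t} s *\<^sub>R (f' s * g' t))
        + integral\<^sup>L (halfline \<Otimes>\<^sub>M halfline) (\<lambda>(s, t). indicat_real {..<s} t *\<^sub>R (f' s * g' t))"
      by (rule Bochner_Integration.integral_add[OF int1 int2])
    also have "integral\<^sup>L (halfline \<Otimes>\<^sub>M halfline) (\<lambda>(s, t). indicat_real {..t} s *\<^sub>R (f' s * g' t))
        = (LINT t|halfline. (LINT s|halfline. indicat_real {..t} s *\<^sub>R (f' s * g' t)))"
      by (rule integral_snd[OF int1, symmetric])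
    also have "\<dots> = (LINT t|halfline. (F t - F 0) * g' t)"
    proof (rule Bochner_Integration.integral_cong[OF refl])
      fix t assume "t \<in> space halfline"
      then have "t > 0" by simp
      have "(LINT s|halfline. indicat_real {..t} s *\<^sub>R (f' s * g' t))
          = (LINT s|halfline. (indicat_real {..t} s *\<^sub>R f' s) * g' t)" by simp
      also have "\<dots> = (LINT s|halfline. indicat_real {..t} s *\<^sub>R f' s) * g' t"
        by (rule integral_mult_left_zero)
      also have "\<dots> = (F t - F 0) * g' t"
        using Fe[of t] \<open>t > 0\<close> by (cases "t \<le> x") (auto simp: g'_def)
      finally show "(LINT s|halfline. indicat_real {..t} s *\<^sub>R (f' s * g' t)) = (F t - F 0) * g' t" .
    qed
    also have "integral\<^sup>L (halfline \<Otimes>\<^sub>M halfline) (\<lambda>(s, t). indicat_real {..<s} t *\<^sub>R (f' s * g' t))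
        = (LINT s|halfline. (LINT t|halfline. indicat_real {..<s} t *\<^sub>R (f' s * g' t)))"
      by (rule integral_fst[OF int2, symmetric])
    also have "\<dots> = (LINT s|halfline. f' s * (G s - G 0))"
    proof (rule Bochner_Integration.integral_cong[OF refl])
      fix s assume "s \<in> space halfline"
      then have "s > 0" by simp
      have "(LINT t|halfline. indicat_real {..<s} t *\<^sub>R (f' s * g' t))
          = (LINT t|halfline. f' s * (indicat_real {..<s} t *\<^sub>R g' t))" by simp
      also have "\<dots> = f' s * (LINT t|halfline. indicat_real {..<s} t *\<^sub>R g' t)"
        by (rule integral_mult_right_zero)
      also have "\<dots> = f' s * (G s - G 0)"
        using Ge[of s] \<open>s > 0\<close> by (cases "s \<le> x") (auto simp: f'_def)
      finally show "(LINT t|halfline. indicat_real {..<s} t *\<^sub>R (f' s * g' t)) = f' s * (G s - G 0)" .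
    qed
    finally have 1: "(F x - F 0) * (G x - G 0)
        = (LINT t|halfline. (F t - F 0) * g' t) + (LINT s|halfline. f' s * (G s - G 0))" .
    have i1: "integrable halfline (\<lambda>t. f' t * G t)" and i2: "integrable halfline (\<lambda>t. F t * g' t)"
      using l1 l2 by (simp_all add: locint_def set_integrable_def f'_def g'_def)
    \<comment> \<open>The identity so far concerns the increments of \<open>F\<close> and
      \<open>G\<close> from 0. Expanding the products with \<open>F 0\<close> and \<open>G 0\<close>
      turns it into the rule for \<open>F\<close> and \<open>G\<close> themselves.\<close>
    have 2: "(LINT t|halfline. (F t - F 0) * g' t) = (LINT t|halfline. F t * g' t) - F 0 * (G x - G 0)"
      using i2 gi by (simp add: left_diff_distrib Ix[symmetric])
    have 3: "(LINT t|halfline. f' t * (G t - G 0)) = (LINT t|halfline. f' t * G t) - (F x - F 0) * G 0"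
      using i1 fi by (simp add: right_diff_distrib Ix[symmetric])
    have 4: "(LINT t:{..x}|halfline. f t * G t + F t * g t)
        = (LINT t|halfline. f' t * G t) + (LINT t|halfline. F t * g' t)"
      using i1 i2 by (subst Bochner_Integration.integral_add[symmetric])
        (auto simp: set_lebesgue_integral_def f'_def g'_def scaleR_add_right)
    show "F x * G x - F 0 * G 0 = (LINT t:{..x}|halfline. f t * G t + F t * g t)"
      using 1 unfolding 2 3 4 by (simp add: algebra_simps)
  qed
qed

section \<open>Behaviour at infinity\<close>

lemma primitive_tendsto:
  assumes F: "primitive f F" and f: "integrable halfline f"
  shows "(F \<longlongrightarrow> F 0 + integral\<^sup>L halfline f) at_top"
proof -
  have "((\<lambda>x. LINT t|halfline. indicat_real {..x} t *\<^sub>R f t) \<longlongrightarrow> integral\<^sup>L halfline f) at_top"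
  proof (rule integral_dominated_convergence_at_top[where w = "\<lambda>t. norm (f t)"])
    show "AE t in halfline. ((\<lambda>x. indicat_real {..x} t *\<^sub>R f t) \<longlongrightarrow> f t) at_top"
    proof (rule AE_I2, rule tendsto_eventually)
      show "\<forall>\<^sub>F x in at_top. indicat_real {..x} t *\<^sub>R f t = f t" for t
        using eventually_ge_at_top[of t] by eventually_elim simp
    qed
  qed (use f in \<open>auto simp: indicator_def\<close>)
  then have "((\<lambda>x. F 0 + (LINT t|halfline. indicat_real {..x} t *\<^sub>R f t)) \<longlongrightarrow> F 0 + integral\<^sup>L halfline f) at_top"
    by (intro tendsto_intros)
  then show ?thesis
  proof (rule Lim_transform_eventually)
    show "\<forall>\<^sub>F x in at_top. F 0 + (LINT t|halfline. indicat_real {..x} t *\<^sub>R f t) = F x"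
      using eventually_ge_at_top[of 0]
    proof eventually_elim
      case (elim x)
      then have "F x - F 0 = (LINT t|halfline. indicat_real {..x} t *\<^sub>R f t)"
        using F by (simp add: primitive_def set_lebesgue_integral_def)
      then show ?case by (simp add: algebra_simps)
    qed
  qed
      qed

text \<open>A nonzero limit would keep the norm above half of \<open>norm L\<close> on arbitrarily
  long intervals, whose contributions exceed any finite integral.\<close>

lemma integrable_limit_at_top_eq_0:
  assumes F: "integrable halfline F" and lim: "(F \<longlongrightarrow> L) at_top"
  shows "L = (0::complex)"
proof (rule ccontr)
  assume "L \<noteq> 0"
  have "((\<lambda>x. norm (F x)) \<longlongrightarrow> norm L) at_top" using lim by (rule tendsto_norm)
  then have "\<forall>\<^sub>F x in at_top. norm L / 2 < norm (F x)"
    by (rule order_tendstoD) (use \<open>L \<noteq> 0\<close> in simp)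
  then obtain X where X: "\<And>x. x \<ge> X \<Longrightarrow> norm L / 2 < norm (F x)"
    unfolding eventually_at_top_linorder by blast
  define Y where "Y = max X 0"
  have "real n * (norm L / 2) \<le> (LINT x|halfline. norm (F x))" for n
  proof -
    have "{Y<..Y + real n} \<in> sets halfline" by (simp add: sets_halfline_Ioc Y_def)
    then have *: "has_bochner_integral halfline (\<lambda>x. indicator {Y<..Y + real n} x *\<^sub>R (norm L / 2)) (real n *\<^sub>R (norm L / 2))"
      using emeasure_halfline_Ioc[of Y "Y + real n"] has_bochner_integral_indicator[of "{Y<..Y + real n}" halfline "norm L / 2"]
      by (simp add: Y_def measure_def)
    have "integral\<^sup>L halfline (\<lambda>x. indicator {Y<..Y + real n} x *\<^sub>R (norm L / 2)) \<le> (LINT x|halfline. norm (F x))"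
    proof (rule integral_mono)
      show "integrable halfline (\<lambda>x. indicator {Y<..Y + real n} x *\<^sub>R (norm L / 2))"
        using * by (simp add: has_bochner_integral_iff)
      show "indicator {Y<..Y + real n} x *\<^sub>R (norm L / 2) \<le> norm (F x)" for x
        using X[of x] by (auto simp: indicator_def Y_def)
    qed (use F in simp)
    then show ?thesis unfolding has_bochner_integral_integral_eq[OF *] by simp
  qed
  moreover obtain n :: nat where "(LINT x|halfline. norm (F x)) / (norm L / 2) < real n"
    using reals_Archimedean2 by blast
  ultimately show False using \<open>L \<noteq> 0\<close> by (smt (verit) divide_less_eq zero_less_norm_iff half_gt_zero)
qed

text \<open>The form in which integration by parts is applied: integrability of \<open>F\<close>
  itself removes the contribution at infinity, leaving only the value at 0.\<close>

lemma integral_primitive: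
  assumes "primitive f F" "integrable halfline f" "integrable halfline F"
  shows "integral\<^sup>L halfline f = - F 0"
  using integrable_limit_at_top_eq_0[OF assms(3) primitive_tendsto[OF assms(1,2)]]
  by (metis add_eq_0_iff)

text \<open>The averages of \<open>f\<close> over short intervals converge to \<open>f\<close>
  almost everywhere, yet they are all 0. Nothing is assumed near 0, so the argument runs on each ray
  starting at \<open>c > 0\<close>, and the exceptional sets for \<open>c = 1 / Suc n\<close> are
  united.\<close>

lemma AE_halfline_eq_0I:
  fixes f :: "real \<Rightarrow> complex"
  assumes f: "\<And>c d. 0 < c \<Longrightarrow> c \<le> d \<Longrightarrow> (f has_integral 0) {c..d}"
  shows "AE x in halfline. f x = 0"
proof -
  have "\<exists>N. negligible N \<and> (\<forall>x. x \<notin> N \<longrightarrow> x > c \<longrightarrow> f x = 0)" if c: "c > 0" for c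
  proof -
    define g where "g x = (if x \<in> {c..} then f x else 0)" for x
    have g: "g integrable_on cbox a b" for a b
    proof -
      have *: "{c..} \<inter> cbox a b = {max a c..b}" by auto
      have "f integrable_on {max a c..b}"
      proof (cases "max a c \<le> b")
        case True
        then show ?thesis using f[of "max a c" b] c unfolding integrable_on_def by fastforce
      qed (simp add: integrable_on_empty)
      then show ?thesis
        unfolding g_def integrable_restrict_Int * .
    qed
    \<comment> \<open>Lebesgue differentiation of the vanishing indefinite integral\<close>
    obtain N where N: "negligible N" "\<And>x e. x \<notin> N \<Longrightarrow> 0 < e \<Longrightarrow>
               \<exists>d>0. \<forall>h. 0 < h \<and> h < d \<longrightarrow>
                         norm (integral (cbox x (x + h *\<^sub>R One)) g /\<^sub>R h ^ DIM(real) - g x) < e"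
      using integrable_ccontinuous_explicit[OF g] by blast
    have "f x = 0" if "x \<notin> N" "x > c" for x
    proof (rule ccontr)
      assume "f x \<noteq> 0"
      then obtain d where d: "d > 0" "\<And>h. 0 < h \<and> h < d \<Longrightarrow>
          norm (integral (cbox x (x + h *\<^sub>R One)) g /\<^sub>R h ^ DIM(real) - g x) < norm (f x)"
        using N(2)[OF \<open>x \<notin> N\<close>, of "norm (f x)"] by auto
      \<comment> \<open>The tolerance was taken to be \<open>norm (f x)\<close>: an average equal to
        0 would have to lie strictly closer to \<open>f x\<close> than 0 does.\<close>
      have "(g has_integral 0) {x..x + d / 2}"
        using f[of x "x + d / 2"] c that d(1) unfolding g_def
        by (subst has_integral_cong[of _ _ f]) auto
      then show False
        using d(2)[of "d / 2"] d(1) that by (auto simp: integral_unique g_def)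
    qed
    then show ?thesis using N(1) by blast
  qed
  then obtain N where N: "\<And>c. c > 0 \<Longrightarrow> negligible (N c)"
      "\<And>c x. c > 0 \<Longrightarrow> x \<notin> N c \<Longrightarrow> x > c \<Longrightarrow> f x = 0" by metis
  have "negligible (\<Union>n. N (1 / real (Suc n)))"
    by (rule negligible_countable_Union) (use N(1) in auto)
  moreover have "f x = 0" if "x > 0" "x \<notin> (\<Union>n. N (1 / real (Suc n)))" for x
  proof -
    obtain n where "1 / real (Suc n) < x" using \<open>x > 0\<close> nat_approx_posE by blast
    then show ?thesis using N(2)[of "1 / real (Suc n)" x] that by auto
  qed
  ultimately show ?thesis
    unfolding AE_halfline_iff eventually_ae_filter_negligible by blast
qed

section \<open>Weak derivatives\<close>

lemma L1_loc_set_integrable: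
  assumes "f \<in> L1_loc" "0 < c"
  shows "set_integrable halfline {c..d} f"
proof -
  have "integrable (lebesgue_on {c..d}) f"
    using assms unfolding L1_loc_def by (auto dest!: spec[of _ "{c..d}"])
  then have "f absolutely_integrable_on {c..d}"
    by (subst (asm) integrable_restrict_space) (simp_all add: set_integrable_def)
  moreover have "{0<..} \<inter> {c..d} = {c..d}" using assms(2) by auto
  ultimately show ?thesis by (simp add: set_integrable_halfline_iff)
qed

lemma locint_imp_L1_loc:
  assumes "locint f"
  shows "f \<in> L1_loc"
  unfolding L1_loc_def
proof (intro CollectI allI impI)
  fix K :: "real set" assume K: "compact K" "K \<subseteq> {0<..}"
  obtain d where "\<forall>x\<in>K. \<bar>x\<bar> \<le> d" using compact_imp_bounded[OF K(1)] by (auto simp: bounded_iff)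
  then have "K \<subseteq> {0..d}" using K(2) by force
  moreover have "f absolutely_integrable_on {0..d}"
    using assms by (simp add: locint_def flip: halfline_Iic_iff)
  moreover have "K \<in> sets lebesgue" using K(1) by (simp add: compact_imp_closed)
  ultimately show "integrable (lebesgue_on K) f"
    by (intro absolutely_integrable_imp_integrable) (auto intro: set_integrable_subset)
qed

lemma locint_continuous:
  assumes "continuous_on {0..} f"
  shows "locint f"
  unfolding locint_def halfline_Iic_iff
  by (intro allI absolutely_integrable_continuous_real) (use assms in \<open>auto intro: continuous_on_subset\<close>)

lemma L1_loc_lincomb:
  assumes "f \<in> L1_loc" "g \<in> L1_loc"
  shows "(\<lambda>x. f x + c * g x) \<in> L1_loc"
  using assms unfolding L1_loc_def
  by (auto intro!: Bochner_Integration.integrable_add)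

lemma L1_loc_const: "(\<lambda>_. c) \<in> L1_loc"
  by (rule locint_imp_L1_loc[OF locint_continuous]) simp

lemma test_integrable:
  assumes \<phi>: "\<phi> \<in> test_functions" and f: "f \<in> L1_loc"
  shows "integrable halfline (\<lambda>x. \<phi> x *\<^sub>R f x)"
proof -
  obtain c d where cd: "0 < c" "c < d" "\<And>x. x \<notin> {c..d} \<Longrightarrow> \<phi> x = 0"
    using test_supportE[OF \<phi>] by blast
  have cont: "continuous_on S \<phi>" for S by (rule smooth_continuous_on[OF test_smooth[OF \<phi>]])
  have "bounded (\<phi> ` {c..d})" by (intro compact_imp_bounded compact_continuous_image cont) simp
  then obtain C where C: "\<And>x. x \<in> {c..d} \<Longrightarrow> \<bar>\<phi> x\<bar> \<le> C"
    unfolding bounded_iff by (metis imageI real_norm_def)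
  have i: "integrable halfline (\<lambda>x. indicator {c..d} x *\<^sub>R f x)"
    using L1_loc_set_integrable[OF f cd(1)] by (simp add: set_integrable_def)
  have [measurable]: "(\<lambda>x. indicator {c..d} x *\<^sub>R f x) \<in> borel_measurable halfline"
    "\<phi> \<in> borel_measurable halfline"
    using i borel_measurable_halfline_continuous[OF cont] by auto
  have eq: "\<phi> x *\<^sub>R f x = \<phi> x *\<^sub>R (indicator {c..d} x *\<^sub>R f x)" for x
    using cd(3)[of x] by (auto simp: indicator_def)
  have "norm (\<phi> x *\<^sub>R (indicator {c..d} x *\<^sub>R f x)) \<le> norm (C *\<^sub>R (indicator {c..d} x *\<^sub>R f x))" for x
    using C[of x] by (auto simp: indicator_def intro!: mult_right_mono)
  then show ?thesis
    unfolding eq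
  proof (intro Bochner_Integration.integrable_bound[OF integrable_scaleR_right[OF i, of C]] AE_I2)
    show "(\<lambda>x. \<phi> x *\<^sub>R (indicator {c..d} x *\<^sub>R f x)) \<in> borel_measurable halfline"
      by (rule borel_measurable_scaleR) measurable
  qed
qed

lemma integral_bump_tendsto:
  assumes f: "f \<in> L1_loc" and "0 < c" "c < d"
  shows "(\<lambda>n. LINT x|halfline. bump c d n x *\<^sub>R f x) \<longlonglongrightarrow> (LINT x:{c<..<d}|halfline. f x)"
  unfolding set_lebesgue_integral_def
proof (rule integral_dominated_convergence[where w = "\<lambda>x. norm (indicator {c..d} x *\<^sub>R f x)"])
  show int: "integrable halfline (\<lambda>x. norm (indicator {c..d} x *\<^sub>R f x))"
    using L1_loc_set_integrable[OF assms(1,2)] by (intro integrable_norm) (simp add: set_integrable_def)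
  show lim: "AE x in halfline. (\<lambda>n. bump c d n x *\<^sub>R f x) \<longlonglongrightarrow> indicat_real {c<..<d} x *\<^sub>R f x"
    by (intro AE_I2 tendsto_intros bump_tendsto assms)
  show "AE x in halfline. norm (bump c d n x *\<^sub>R f x) \<le> norm (indicator {c..d} x *\<^sub>R f x)" for n
  proof (rule AE_I2)
    fix x
    show "norm (bump c d n x *\<^sub>R f x) \<le> norm (indicator {c..d} x *\<^sub>R f x)"
      using bump_eq_0[OF \<open>c < d\<close>, of x n] bump_nonneg[of c d n x] bump_le_1[of c d n x]
      by (auto simp: indicator_def mult_left_le_one_le)
  qed
  show m: "(\<lambda>x. bump c d n x *\<^sub>R f x) \<in> borel_measurable halfline" for n
    using test_integrable[OF bump_test[OF assms(2,3)] f] by (rule borel_measurable_integrable)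
  show "(\<lambda>x. indicat_real {c<..<d} x *\<^sub>R f x) \<in> borel_measurable halfline"
  proof (rule borel_measurable_LIMSEQ_metric[OF m])
    show "(\<lambda>n. bump c d n x *\<^sub>R f x) \<longlonglongrightarrow> indicat_real {c<..<d} x *\<^sub>R f x" for x
      by (intro tendsto_intros bump_tendsto assms)
  qed
qed

text \<open>Bumps converge boundedly to indicators of intervals, so vanishing against test functions
  passes to vanishing integrals over intervals.\<close>

lemma fundamental_lemma:
  assumes f: "f \<in> L1_loc"
    and 0: "\<And>\<phi>. \<phi> \<in> test_functions \<Longrightarrow> (LINT x|halfline. \<phi> x *\<^sub>R f x) = 0"
  shows "AE x in halfline. f x = 0"
proof (rule AE_halfline_eq_0I)
  fix c d :: real assume cd: "0 < c" "c \<le> d"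
  show "(f has_integral 0) {c..d}"
  proof (cases "c = d")
    case False
    then have "c < d" using cd by simp
    have eq: "{0<..} \<inter> {c..d} = {c..d}" "{0<..} \<inter> {c<..<d} = {c<..<d}" using cd by auto
    have ai: "f absolutely_integrable_on {c..d}"
      using L1_loc_set_integrable[OF f cd(1), of d] unfolding set_integrable_halfline_iff eq .
    then have ai': "f absolutely_integrable_on {c<..<d}"
      by (rule set_integrable_subset) auto
    have "(\<lambda>n. 0) \<longlonglongrightarrow> (LINT x:{c<..<d}|halfline. f x)"
      using integral_bump_tendsto[OF f cd(1) \<open>c < d\<close>] 0[OF bump_test[OF cd(1) \<open>c < d\<close>]] by simp
    then have "integral {c<..<d} f = 0"
      using set_integral_halfline_eq[of "{c<..<d}" f] ai' by (simp add: eq LIMSEQ_const_iff)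
    then have "integral {c..d} f = 0" by (simp add: integral_open_interval_real)
    then show ?thesis
      using ai set_lebesgue_integral_eq_integral(1) has_integral_integral by metis
  qed (simp add: has_integral_refl)
qed

text \<open>Zero mean is precisely what makes the integral from 0 vanish again to the right of the
  support.\<close>

lemma test_primitive:
  assumes \<phi>: "\<phi> \<in> test_functions" and int: "integral\<^sup>L halfline \<phi> = 0"
  obtains \<eta> where "\<eta> \<in> test_functions" "deriv \<eta> = \<phi>"
proof -
  obtain c d where cd: "0 < c" "c < d" "\<And>x. x \<notin> {c..d} \<Longrightarrow> \<phi> x = 0"
    using test_supportE[OF \<phi>] by blast
  have cont: "continuous_on S \<phi>" for S by (rule smooth_continuous_on[OF test_smooth[OF \<phi>]])
  define \<eta> where "\<eta> x = integral {0..x} \<phi>" for x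
  have \<eta>0: "\<eta> x = 0" if "x < c" for x
    unfolding \<eta>_def by (intro integral_unique has_integral_is_0) (use cd that in auto)
  have \<eta>1: "\<eta> x = 0" if "x > d" for x
  proof -
    have ai: "set_integrable halfline {..x} \<phi>"
      unfolding halfline_Iic_iff by (rule absolutely_integrable_continuous_real[OF cont])
    have "indicator {..x} t *\<^sub>R \<phi> t = \<phi> t" for t
      using cd(3)[of t] that by (auto simp: indicator_def)
    then have "(LINT t:{..x}|halfline. \<phi> t) = 0"
      unfolding set_lebesgue_integral_def using int by (simp only:)
    then show ?thesis using halfline_Iic_integral[OF ai] by (simp add: \<eta>_def)
  qed
  \<comment> \<open>To the left of \<open>c\<close>, including all negative points where the
    integral runs over an empty interval, \<open>\<eta>\<close> is locally 0. From \<open>c\<close>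
    on, \<open>x\<close> is an interior point of an interval starting at 0, and the fundamental
    theorem gives a two-sided derivative.\<close>
  have der: "(\<eta> has_real_derivative \<phi> x) (at x)" for x
  proof (cases "x < c")
    case True
    have "eventually (\<lambda>y. \<eta> y = 0) (nhds x)"
      using eventually_nhds_in_open[of "{..<c}" x] True by (auto elim!: eventually_mono simp: \<eta>0)
    then have "(\<eta> has_real_derivative 0) (at x)"
      using DERIV_cong_ev[of x x \<eta> "\<lambda>_. 0" 0 0] by simp
    then show ?thesis using cd True by auto
  next
    case False
    then have "x \<in> {0<..<x + 1}" using cd by auto
    moreover have "(\<eta> has_real_derivative \<phi> x) (at x within {0..x + 1})"
      unfolding \<eta>_def using calculation by (intro integral_has_real_derivative cont) auto
    ultimately show ?thesis using at_within_Icc_at[of 0 x "x + 1"] by simp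
  qed
  have "smooth \<eta>"
  proof (rule smooth_coinduct[where S = "insert \<eta> (range (\<lambda>n. (deriv ^^ n) \<phi>))"])
    fix g assume "g \<in> insert \<eta> (range (\<lambda>n. (deriv ^^ n) \<phi>))"
    then consider "g = \<eta>" | n where "g = (deriv ^^ n) \<phi>" by blast
    then show "\<exists>h\<in>insert \<eta> (range (\<lambda>n. (deriv ^^ n) \<phi>)). \<forall>x. (g has_real_derivative h x) (at x)"
    proof cases
      case 1
      moreover have "\<phi> = (deriv ^^ 0) \<phi>" by simp
      ultimately show ?thesis using der by blast
    next
      case 2
      have "(g has_real_derivative (deriv ^^ Suc n) \<phi> x) (at x)" for x
        using smooth_deriv[OF smooth_higher_deriv[OF test_smooth[OF \<phi>], of n]] 2 by simp
      then show ?thesis by blast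
    qed
  qed simp
  moreover have "\<eta> x = 0" if "x \<notin> {c..d}" for x using that \<eta>0 \<eta>1 by force
  ultimately have "\<eta> \<in> test_functions" using cd unfolding test_functions_iff by blast
  moreover have "deriv \<eta> = \<phi>" using der by (auto intro!: ext DERIV_imp_deriv)
  ultimately show ?thesis using that by blast
qed

text \<open>Subtracting a multiple of a fixed test function \<open>\<psi>\<close> of nonzero mass
  from \<open>\<phi>\<close> gives mean zero, hence a derivative of a test function. So testing
  \<open>f\<close> against \<open>\<phi>\<close> depends only on the mean of \<open>\<phi>\<close>,
  as for a constant.\<close>

lemma du_Bois_Reymond:
  assumes f: "f \<in> L1_loc"
    and 0: "\<And>\<phi>. \<phi> \<in> test_functions \<Longrightarrow> (LINT x|halfline. deriv \<phi> x *\<^sub>R f x) = 0"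
  obtains C where "AE x in halfline. f x = C"
proof -
  have int1: "integrable halfline \<phi>" if "\<phi> \<in> test_functions" for \<phi>
    using integrable_Re[OF test_integrable[OF that L1_loc_const[of 1]]] by simp
  \<comment> \<open>The masses of the bumps tend to the length 1 of the interval, so some bump has
    nonzero mass.\<close>
  have "(\<lambda>n. LINT x|halfline. bump 1 2 n x *\<^sub>R (1::complex)) \<longlonglongrightarrow> (LINT x:{1<..<2}|halfline. 1)"
    by (rule integral_bump_tendsto[OF L1_loc_const]) auto
  moreover have "(LINT x:{1<..<2}|halfline. 1) = (1::complex)"
  proof -
    have *: "{0<..} \<inter> {1<..<2} = {1<..<2::real}" by auto
    have "(\<lambda>_. 1::complex) absolutely_integrable_on {1<..<2::real}"
      by (rule set_integrable_subset[OF absolutely_integrable_continuous_real[of 1 2]]) auto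
    then show ?thesis
      by (subst set_integral_halfline_eq) (simp_all add: * flip: integral_open_interval_real)
  qed
  ultimately have "\<forall>\<^sub>F n in sequentially. (LINT x|halfline. bump 1 2 n x *\<^sub>R (1::complex)) \<noteq> 0"
    by (intro tendsto_imp_eventually_ne) auto
  then obtain n where n: "(LINT x|halfline. bump 1 2 n x *\<^sub>R (1::complex)) \<noteq> 0"
    by (auto simp: eventually_sequentially)
  define \<psi> where "\<psi> = bump 1 2 n"
  define I where "I = integral\<^sup>L halfline \<psi>"
  have \<psi>: "\<psi> \<in> test_functions" unfolding \<psi>_def by (rule bump_test) auto
  have "I \<noteq> 0"
    using n int1[OF \<psi>] by (auto simp: I_def \<psi>_def scaleR_conv_of_real)
  \<comment> \<open>The only candidate: its value is forced by testing the equation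
    \<open>f = C\<close> against \<open>\<psi>\<close>.\<close>
  define C where "C = (LINT x|halfline. \<psi> x *\<^sub>R f x) / of_real I"
  have "AE x in halfline. f x + (- 1) * C = 0"
  proof (rule fundamental_lemma)
    show "(\<lambda>x. f x + - 1 * C) \<in> L1_loc" by (rule L1_loc_lincomb[OF f L1_loc_const])
    fix \<phi> assume \<phi>: "\<phi> \<in> test_functions"
    define k where "k = integral\<^sup>L halfline \<phi> / I"
    have "(\<lambda>x. \<phi> x + (- k) * \<psi> x) \<in> test_functions" by (rule test_lincomb[OF \<phi> \<psi>])
    moreover have "(LINT x|halfline. \<phi> x + (- k) * \<psi> x) = 0"
      using int1[OF \<phi>] int1[OF \<psi>] \<open>I \<noteq> 0\<close> by (simp add: k_def flip: I_def)
    ultimately obtain \<eta> where \<eta>: "\<eta> \<in> test_functions" "deriv \<eta> = (\<lambda>x. \<phi> x + (- k) * \<psi> x)"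
      by (rule test_primitive)
    note i = test_integrable[OF \<phi> f] test_integrable[OF \<psi> f] test_integrable[OF \<phi> L1_loc_const[of C]]
    have "(LINT x|halfline. \<phi> x *\<^sub>R f x - k *\<^sub>R (\<psi> x *\<^sub>R f x)) = 0"
      using 0[OF \<eta>(1)] unfolding \<eta>(2) by (simp add: scaleR_left_diff_distrib)
    moreover have "(LINT x|halfline. \<phi> x *\<^sub>R f x - k *\<^sub>R (\<psi> x *\<^sub>R f x))
        = (LINT x|halfline. \<phi> x *\<^sub>R f x) - (LINT x|halfline. k *\<^sub>R (\<psi> x *\<^sub>R f x))"
      using i by (intro Bochner_Integration.integral_diff integrable_scaleR_right) auto
    moreover have "(LINT x|halfline. k *\<^sub>R (\<psi> x *\<^sub>R f x)) = k *\<^sub>R (LINT x|halfline. \<psi> x *\<^sub>R f x)"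
      by (rule integral_scaleR_right)
    ultimately have "(LINT x|halfline. \<phi> x *\<^sub>R f x) = k *\<^sub>R (LINT x|halfline. \<psi> x *\<^sub>R f x)"
      by simp
    also have "\<dots> = integral\<^sup>L halfline \<phi> *\<^sub>R C"
      using \<open>I \<noteq> 0\<close> by (simp add: C_def k_def scaleR_conv_of_real)
    also have "\<dots> = (LINT x|halfline. \<phi> x *\<^sub>R C)" using int1[OF \<phi>] by simp
    finally show "(LINT x|halfline. \<phi> x *\<^sub>R (f x + - 1 * C)) = 0"
      using i by (simp add: scaleR_right_diff_distrib)
  qed
  then show ?thesis by (intro that[of C]) simp
qed

section \<open>Uniqueness and algebra of weak derivatives\<close>

lemma has_weak_deriv_unique:
  assumes v: "has_weak_deriv j u v" and w: "has_weak_deriv j u w"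
  shows "AE x in halfline. v x = w x"
proof -
  have L: "v \<in> L1_loc" "w \<in> L1_loc" using v w by (auto simp: has_weak_deriv_def)
  have "AE x in halfline. v x + (- 1) * w x = 0"
  proof (rule fundamental_lemma)
    show "(\<lambda>x. v x + (- 1) * w x) \<in> L1_loc" by (rule L1_loc_lincomb[OF L])
    fix \<phi> assume \<phi>: "\<phi> \<in> test_functions"
    have "(-1) ^ j * (LINT x|halfline. \<phi> x *\<^sub>R v x) = (-1) ^ j * (LINT x|halfline. \<phi> x *\<^sub>R w x)"
      using bspec[OF conjunct2[OF conjunct2[OF v[unfolded has_weak_deriv_def]]] \<phi>]
        bspec[OF conjunct2[OF conjunct2[OF w[unfolded has_weak_deriv_def]]] \<phi>] by simp
    then have "(LINT x|halfline. \<phi> x *\<^sub>R v x) = (LINT x|halfline. \<phi> x *\<^sub>R w x)" by simp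
    then show "(LINT x|halfline. \<phi> x *\<^sub>R (v x + (- 1) * w x)) = 0"
      using test_integrable[OF \<phi> L(1)] test_integrable[OF \<phi> L(2)]
      by (simp add: scaleR_right_diff_distrib)
  qed
  then show ?thesis by simp
qed

lemma has_weak_deriv_weak_deriv: "has_weak_deriv j u v \<Longrightarrow> has_weak_deriv j u (weak_deriv j u)"
  unfolding weak_deriv_def by (metis someI)

lemma has_weak_deriv_lincomb:
  assumes "has_weak_deriv j u v" "has_weak_deriv j u' v'"
  shows "has_weak_deriv j (\<lambda>x. u x + c * u' x) (\<lambda>x. v x + c * v' x)"
  unfolding has_weak_deriv_def
proof (intro conjI ballI)
  show "(\<lambda>x. u x + c * u' x) \<in> L1_loc" "(\<lambda>x. v x + c * v' x) \<in> L1_loc"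
    using assms by (auto simp: has_weak_deriv_def intro!: L1_loc_lincomb)
  have split: "(LINT x|halfline. \<phi> x *\<^sub>R (f x + c * g x))
      = (LINT x|halfline. \<phi> x *\<^sub>R f x) + c * (LINT x|halfline. \<phi> x *\<^sub>R g x)"
    if "\<phi> \<in> test_functions" "f \<in> L1_loc" "g \<in> L1_loc" for \<phi> f g
  proof -
    have "\<phi> x *\<^sub>R (f x + c * g x) = \<phi> x *\<^sub>R f x + c * (\<phi> x *\<^sub>R g x)" for x
      by (simp add: scaleR_add_right)
    then have "(LINT x|halfline. \<phi> x *\<^sub>R (f x + c * g x))
        = (LINT x|halfline. \<phi> x *\<^sub>R f x + c * (\<phi> x *\<^sub>R g x))" by (simp only:)
    also have "\<dots> = (LINT x|halfline. \<phi> x *\<^sub>R f x) + (LINT x|halfline. c * (\<phi> x *\<^sub>R g x))"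
      using test_integrable[OF that(1,2)] test_integrable[OF that(1,3)]
      by (intro Bochner_Integration.integral_add integrable_mult_right) auto
    also have "(LINT x|halfline. c * (\<phi> x *\<^sub>R g x)) = c * (LINT x|halfline. \<phi> x *\<^sub>R g x)"
      by (rule integral_mult_right_zero)
    finally show ?thesis .
  qed
  fix \<phi> assume \<phi>: "\<phi> \<in> test_functions"
  show "(LINT x|halfline. (deriv ^^ j) \<phi> x *\<^sub>R (u x + c * u' x))
      = (- 1) ^ j * (LINT x|halfline. \<phi> x *\<^sub>R (v x + c * v' x))"
    using assms \<phi> test_higher_deriv[OF \<phi>, of j]
    by (simp add: split has_weak_deriv_def distrib_left mult.left_commute del: scaleR_right_distrib)
qed

text \<open>Test the order \<open>i\<close> identity with the \<open>j\<close>-th derivative of a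
  test function. In \<open>sobolev_H\<close> every derivative refers to \<open>u\<close> directly;
  this lemma relates consecutive ones to each other.\<close>

lemma has_weak_deriv_diff:
  assumes v: "has_weak_deriv i u v" and w: "has_weak_deriv (i + j) u w"
  shows "has_weak_deriv j v w"
  unfolding has_weak_deriv_def
proof (intro conjI ballI)
  show "v \<in> L1_loc" "w \<in> L1_loc" using v w by (auto simp: has_weak_deriv_def)
  fix \<phi> assume \<phi>: "\<phi> \<in> test_functions"
  have "(LINT x|halfline. (deriv ^^ i) ((deriv ^^ j) \<phi>) x *\<^sub>R u x)
      = (- 1) ^ i * (LINT x|halfline. (deriv ^^ j) \<phi> x *\<^sub>R v x)"
    using v test_higher_deriv[OF \<phi>] by (simp add: has_weak_deriv_def)
  moreover have "(LINT x|halfline. (deriv ^^ i) ((deriv ^^ j) \<phi>) x *\<^sub>R u x)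
      = (- 1) ^ (i + j) * (LINT x|halfline. \<phi> x *\<^sub>R w x)"
    using w \<phi> by (simp add: has_weak_deriv_def funpow_add)
  ultimately show "(LINT x|halfline. (deriv ^^ j) \<phi> x *\<^sub>R v x) = (- 1) ^ j * (LINT x|halfline. \<phi> x *\<^sub>R w x)"
    by (simp add: power_add)
qed

lemma has_weak_deriv_0: "has_weak_deriv 0 u v \<Longrightarrow> has_weak_deriv 0 u u"
  by (simp add: has_weak_deriv_def)

text \<open>By the product rule the integral of \<open>v\<close> from 0 has weak derivative
  \<open>v\<close>. Its difference from \<open>u\<close> therefore has weak derivative 0 and is
  constant almost everywhere.\<close>

lemma weak_deriv_primitive:
  assumes uv: "has_weak_deriv 1 u v" and v: "locint v"
  obtains U where "primitive v U" "AE x in halfline. u x = U x"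
proof -
  define U where "U x = (LINT t:{..x}|halfline. v t)" for x
  have "U 0 = 0"
    unfolding U_def set_lebesgue_integral_def
    by (rule integral_eq_zero_AE, rule AE_I2) (simp add: indicator_def)
  then have U: "primitive v U" using v by (simp add: primitive_def U_def)
  have L: "u \<in> L1_loc" "v \<in> L1_loc" "U \<in> L1_loc"
    using uv locint_imp_L1_loc[OF locint_continuous[OF primitive_continuous_on[OF U]]]
    by (auto simp: has_weak_deriv_def)
  obtain C where "AE x in halfline. u x + (- 1) * U x = C"
  proof (rule du_Bois_Reymond)
    show "(\<lambda>x. u x + (- 1) * U x) \<in> L1_loc" by (rule L1_loc_lincomb[OF L(1,3)])
    fix \<phi> assume \<phi>: "\<phi> \<in> test_functions"
    obtain c d where cd: "0 < c" "c < d" "\<And>x. x \<notin> {c..d} \<Longrightarrow> \<phi> x = 0"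
      using test_supportE[OF \<phi>] by blast
    obtain c' d' where cd': "0 < c'" "c' < d'" "\<And>x. x \<notin> {c'..d'} \<Longrightarrow> deriv \<phi> x = 0"
      using test_supportE[OF test_deriv[OF \<phi>]] by blast
    have P: "primitive (\<lambda>x. of_real (deriv \<phi> x)) (\<lambda>x. of_real (\<phi> x))"
    proof (rule primitiveI_C1)
      show "((\<lambda>x. complex_of_real (\<phi> x)) has_vector_derivative of_real (deriv \<phi> x)) (at x within {0..})" for x
        using smooth_deriv[OF test_smooth[OF \<phi>], of x]
        by (intro has_vector_derivative_of_real has_vector_derivative_at_within)
          (simp add: has_real_derivative_iff_has_vector_derivative)
      show "continuous_on {0..} (\<lambda>x. complex_of_real (deriv \<phi> x))"
        by (intro continuous_on_of_real smooth_continuous_on test_smooth test_deriv \<phi>)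
    qed
    \<comment> \<open>A point beyond the supports of both \<open>\<phi>\<close> and
      \<open>deriv \<phi>\<close>: the boundary terms vanish and the integral up to \<open>x\<close>
      is the integral over the half-line.\<close>
    define x where "x = max d d' + 1"
    have "of_real (\<phi> x) * U x - of_real (\<phi> 0) * U 0
        = (LINT t:{..x}|halfline. of_real (deriv \<phi> t) * U t + of_real (\<phi> t) * v t)"
      using primitive_mult[OF P U] cd by (simp add: primitive_def x_def)
    moreover have "\<phi> x = 0" "\<phi> 0 = 0" using cd(1,2) by (auto intro!: cd(3) simp: x_def)
    moreover have "(LINT t:{..x}|halfline. of_real (deriv \<phi> t) * U t + of_real (\<phi> t) * v t)
        = (LINT t|halfline. deriv \<phi> t *\<^sub>R U t + \<phi> t *\<^sub>R v t)"
      unfolding set_lebesgue_integral_def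
    proof (rule Bochner_Integration.integral_cong[OF refl])
      show "indicat_real {..x} t *\<^sub>R (of_real (deriv \<phi> t) * U t + of_real (\<phi> t) * v t)
          = deriv \<phi> t *\<^sub>R U t + \<phi> t *\<^sub>R v t" for t
      proof (cases "t \<le> x")
        case False
        then have "t \<notin> {c..d}" "t \<notin> {c'..d'}" by (auto simp: x_def)
        then have "\<phi> t = 0" "deriv \<phi> t = 0" by (simp_all only: cd(3) cd'(3) not_False_eq_True)
        then show ?thesis by simp
      qed (simp add: scaleR_conv_of_real)
    qed
    moreover note i = test_integrable[OF test_deriv[OF \<phi>] L(3)] test_integrable[OF \<phi> L(2)]
      test_integrable[OF test_deriv[OF \<phi>] L(1)]
    ultimately have "(LINT t|halfline. deriv \<phi> t *\<^sub>R U t) + (LINT t|halfline. \<phi> t *\<^sub>R v t) = 0"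
      by simp
    moreover have "(LINT t|halfline. deriv \<phi> t *\<^sub>R u t) = - (LINT t|halfline. \<phi> t *\<^sub>R v t)"
      using uv \<phi> by (simp add: has_weak_deriv_def)
    ultimately show "(LINT t|halfline. deriv \<phi> t *\<^sub>R (u t + - 1 * U t)) = 0"
      using i by (simp add: scaleR_right_diff_distrib add_eq_0_iff)
  qed
  then have "AE x in halfline. u x = U x + C" by eventually_elim (simp add: algebra_simps)
  moreover have "primitive v (\<lambda>x. U x + C)" using primitive_add[OF U primitive_const] by simp
  ultimately show ?thesis using that by blast
qed

text \<open>The coincidence set of two continuous representatives is closed and has full measure in
  the open half-line, so it contains the open half-line and its limit point 0.\<close>

lemma trace_eq_value:
  assumes "has_trace u c" "continuous_on {0..} U" "AE x in halfline. u x = U x"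
  shows "U 0 = c"
proof -
  obtain w where w: "continuous_on {0..} w" "AE x in halfline. u x = w x" "w 0 = c"
    using assms(1) by (auto simp: has_trace_def ae_eq_def)
  define C where "C = {0..} \<inter> (\<lambda>x. w x - U x) -` {0}"
  have C: "closed C"
    unfolding C_def by (intro continuous_closed_preimage continuous_intros w assms)
  have "AE x in halfline. x \<in> C"
    using w(2) assms(3) AE_space by eventually_elim (simp add: C_def)
  then have "AE x\<in>{0<..} in lebesgue. x \<in> C"
    unfolding AE_halfline_iff by eventually_elim simp
  then have "{0<..} \<subseteq> C"
    using mem_closed_if_AE_lebesgue_open[OF open_greaterThan C] by blast
  then have "closure {0<..} \<subseteq> C" using C by (rule closure_minimal)
  then have "0 \<in> C" by auto
  then show ?thesis using w by (simp add: C_def)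
qed

section \<open>Square-integrable functions and representatives of Sobolev functions\<close>

lemma L2_measurable: "u \<in> L2 \<Longrightarrow> u \<in> borel_measurable halfline"
  by (simp add: L2_def)

lemma L2_cong_AE:
  assumes "u \<in> L2" "AE x in halfline. u x = v x" "v \<in> borel_measurable halfline"
  shows "v \<in> L2"
proof -
  have [measurable]: "u \<in> borel_measurable halfline" "v \<in> borel_measurable halfline"
    using assms L2_measurable by auto
  have "AE x in halfline. (cmod (u x))\<^sup>2 = (cmod (v x))\<^sup>2" using assms(2) by eventually_elim simp
  then have "integrable halfline (\<lambda>x. (cmod (u x))\<^sup>2) \<longleftrightarrow> integrable halfline (\<lambda>x. (cmod (v x))\<^sup>2)"
    by (intro integrable_cong_AE) measurable
  then show ?thesis using assms by (simp add: L2_def)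
qed

lemma L2_integrable_mult_cnj:
  assumes "u \<in> L2" "v \<in> L2"
  shows "integrable halfline (\<lambda>x. u x * cnj (v x))"
proof -
  have [measurable]: "u \<in> borel_measurable halfline" "v \<in> borel_measurable halfline"
    using assms L2_measurable by auto
  have [measurable]: "(\<lambda>x. cnj (v x)) \<in> borel_measurable halfline"
    by (rule borel_measurable_continuous_on[where f = cnj]) (auto intro: continuous_intros)
  have int: "integrable halfline (\<lambda>x. (cmod (u x))\<^sup>2 + (cmod (v x))\<^sup>2)"
    using assms by (auto simp: L2_def)
  have b: "cmod (u x) * cmod (v x) \<le> (cmod (u x))\<^sup>2 + (cmod (v x))\<^sup>2" for x
    using sum_squares_bound[of "cmod (u x)" "cmod (v x)"] mult_nonneg_nonneg[of "cmod (u x)" "cmod (v x)"]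
    by (simp del: mult_nonneg_nonneg)
  show ?thesis
    by (rule Bochner_Integration.integrable_bound[OF int]; use b in \<open>simp add: norm_mult\<close>)
qed

text \<open>The bound of \<open>cmod (u t)\<close> by \<open>1 + (cmod (u t))\<^sup>2\<close> works
  on bounded intervals right down to 0, so the representatives extend to the closed
  half-line.\<close>

lemma L2_locint:
  assumes "u \<in> L2"
  shows "locint u"
  unfolding locint_def set_integrable_def
proof
  fix x
  have [measurable]: "u \<in> borel_measurable halfline" using assms L2_measurable by auto
  have "integrable halfline (indicat_real {0<..x})"
  proof (cases "x \<ge> 0")
    case True
    then show ?thesis
      by (intro integrable_real_indicator sets_halfline_Ioc) (simp_all add: emeasure_halfline_Ioc)
  qed simp
  then have "integrable halfline (\<lambda>t. indicat_real {0<..x} t + (cmod (u t))\<^sup>2)"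
    using assms by (simp add: L2_def)
  then show "integrable halfline (\<lambda>t. indicat_real {..x} t *\<^sub>R u t)"
  proof (rule Bochner_Integration.integrable_bound)
    have "cmod (u t) \<le> 1 + (cmod (u t))\<^sup>2" for t
      using sum_squares_bound[of "cmod (u t)" 1] norm_ge_zero[of "u t"] unfolding power_one mult_1_right by linarith
    then show "AE t in halfline. norm (indicat_real {..x} t *\<^sub>R u t)
        \<le> norm (indicat_real {0<..x} t + (cmod (u t))\<^sup>2)"
      by (intro AE_I2) (auto simp: indicator_def)
  qed measurable
qed

lemma sobolev_H_L2_deriv:
  assumes "u \<in> sobolev_H k" "j \<le> k"
  obtains v where "v \<in> L2" "has_weak_deriv j u v"
  using assms by (auto simp: sobolev_H_def)

lemma L1_loc_measurable:
  assumes "f \<in> L1_loc"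
  shows "f \<in> borel_measurable halfline"
proof (rule borel_measurable_LIMSEQ_metric)
  show "(\<lambda>x. indicator {1 / real (Suc n)..real n} x *\<^sub>R f x) \<in> borel_measurable halfline" for n
    using L1_loc_set_integrable[OF assms, of "1 / real (Suc n)"]
    unfolding set_integrable_def by auto
  fix x assume "x \<in> space halfline"
  then have "x > 0" by simp
  show "(\<lambda>n. indicator {1 / real (Suc n)..real n} x *\<^sub>R f x) \<longlonglongrightarrow> f x"
  proof (rule tendsto_eventually)
    obtain N :: nat where "x \<le> real N" using real_arch_simple by blast
    moreover obtain M where "1 / real (Suc M) < x" using nat_approx_posE[OF \<open>x > 0\<close>] by blast
    moreover have "1 / real (Suc n) \<le> 1 / real (Suc M)" if "n \<ge> M" for n
      using that by (intro divide_left_mono) auto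
    ultimately have "indicat_real {1 / real (Suc n)..real n} x = 1" if "n \<ge> max M N" for n
      using that by (force simp: indicator_def)
    then show "\<forall>\<^sub>F n in sequentially. indicator {1 / real (Suc n)..real n} x *\<^sub>R f x = f x"
      by (intro eventually_sequentiallyI[of "max M N"]) simp
  qed
qed

text \<open>The choice operator knows nothing about square integrability; uniqueness transfers it
  from the witness in \<open>sobolev_H\<close>.\<close>

lemma weak_deriv_L2:
  assumes "u \<in> sobolev_H k" "j \<le> k"
  shows "has_weak_deriv j u (weak_deriv j u)" "weak_deriv j u \<in> L2"
proof -
  obtain v where v: "v \<in> L2" "has_weak_deriv j u v" using sobolev_H_L2_deriv[OF assms] by blast
  show w: "has_weak_deriv j u (weak_deriv j u)" by (rule has_weak_deriv_weak_deriv[OF v(2)])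
  show "weak_deriv j u \<in> L2"
    using v(1) has_weak_deriv_unique[OF v(2) w]
    by (rule L2_cong_AE) (use w in \<open>auto simp: has_weak_deriv_def intro: L1_loc_measurable\<close>)
qed

lemma has_weak_deriv_self:
  assumes "u \<in> sobolev_H k"
  shows "has_weak_deriv 0 u u"
  using sobolev_H_L2_deriv[OF assms, of 0] has_weak_deriv_0 by blast

text \<open>One rung of the descent from the highest derivative: the representative obtained at
  order \<open>Suc j\<close> is inserted as \<open>w\<close>, and \<open>U\<close> then serves as
  \<open>w\<close> at the next lower order.\<close>

lemma sobolev_primitive:
  assumes "u \<in> sobolev_H k" "j < k" "AE x in halfline. weak_deriv (Suc j) u x = w x" "w \<in> borel_measurable halfline"
  obtains U where "primitive w U" "AE x in halfline. weak_deriv j u x = U x" "U \<in> L2"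
proof -
  have 1: "has_weak_deriv j u (weak_deriv j u)" "weak_deriv j u \<in> L2"
    and 2: "has_weak_deriv (Suc j) u (weak_deriv (Suc j) u)" "weak_deriv (Suc j) u \<in> L2"
    using weak_deriv_L2[OF assms(1)] assms(2) by auto
  have "has_weak_deriv 1 (weak_deriv j u) (weak_deriv (Suc j) u)"
    by (rule has_weak_deriv_diff[OF 1(1)]) (use 2 in simp)
  then obtain U where U: "primitive (weak_deriv (Suc j) u) U" "AE x in halfline. weak_deriv j u x = U x"
    using weak_deriv_primitive L2_locint[OF 2(2)] by blast
  moreover have "U \<in> L2" using L2_cong_AE[OF 1(2) U(2) primitive_measurable[OF U(1)]] .
  moreover have "primitive w U" by (rule primitive_cong_AE[OF U(1) assms(3,4)])
  ultimately show ?thesis using that by blast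
qed

section \<open>The eigenvalue enclosure\<close>

lemma integrable_bounded_mult:
  fixes h :: "real \<Rightarrow> real" and f :: "real \<Rightarrow> complex"
  assumes h: "h \<in> borel_measurable halfline" and b: "\<And>x. x \<ge> 0 \<Longrightarrow> \<bar>h x\<bar> \<le> C"
    and f: "integrable halfline f"
  shows "integrable halfline (\<lambda>x. of_real (h x) * f x)"
proof (rule Bochner_Integration.integrable_bound[OF integrable_scaleR_right[OF f, of C]])
  have "norm (of_real (h x) * f x) \<le> norm (C *\<^sub>R f x)" if "x \<ge> 0" for x
    using b[OF that] by (auto simp: norm_mult intro!: mult_right_mono)
  then show "AE x in halfline. norm (of_real (h x) * f x) \<le> norm (C *\<^sub>R f x)"
    by (intro AE_I2) simp
  show "(\<lambda>x. of_real (h x) * f x) \<in> borel_measurable halfline"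
    using h f by (intro borel_measurable_times) auto
qed

lemma L2_norm_sq_integrable: "u \<in> L2 \<Longrightarrow> integrable halfline (\<lambda>x. (cmod (u x))\<^sup>2)"
  by (simp add: L2_def)

text \<open>The analytic core, freed from weak derivatives: \<open>u0\<close>, ...,
  \<open>u4\<close> form a chain of primitives, and the eigenvalue equation is written out in terms
  of them.\<close>

lemma numerical_range_inclusion:
  fixes a R Vmin Vmax V1max V2min V2max :: real and V V1 V2 :: "real \<Rightarrow> real" and \<mu> :: complex
  assumes a: "a > 0" and R: "R > 0"
    and V: "\<And>x. x \<ge> 0 \<Longrightarrow> (V has_real_derivative V1 x) (at x within {0..})"
    and V1: "\<And>x. x \<ge> 0 \<Longrightarrow> (V1 has_real_derivative V2 x) (at x within {0..})"
    and V2: "continuous_on {0..} V2"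
    and Vb: "\<And>x. x \<ge> 0 \<Longrightarrow> Vmin \<le> V x \<and> V x \<le> Vmax"
    and V1b: "\<And>x. x \<ge> 0 \<Longrightarrow> \<bar>V1 x\<bar> \<le> V1max"
    and V2b: "\<And>x. x \<ge> 0 \<Longrightarrow> V2min \<le> V2 x \<and> V2 x \<le> V2max"
    and P0: "primitive u1 u0" and P1: "primitive u2 u1" and P2: "primitive u3 u2" and P3: "primitive u4 u3"
    and L: "u0 \<in> L2" "u1 \<in> L2" "u2 \<in> L2" "u3 \<in> L2" "u4 \<in> L2"
    and bc: "u0 0 = 0" "u1 0 = 0"
    and nz: "\<not> (AE x in halfline. u0 x = 0)"
    and eq: "AE x in halfline. u4 x - 2 * of_real (a\<^sup>2) * u2 x + of_real (a ^ 4) * u0 x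
        + \<i> * of_real (a * R) * (of_real (V x) * (of_real (a\<^sup>2) * u0 x - u2 x) + of_real (V2 x) * u0 x)
      = \<mu> * (of_real (a\<^sup>2) * u0 x - u2 x)"
  shows "\<mu> \<in> complex_of_real ` {a\<^sup>2..}
              + (\<i> * of_real (a * R)) *o (complex_of_real ` {Vmin..Vmax})
              + complex_of_real (R / 2 * V1max) *o cball 0 1"
proof -
  define e where "e x = (cmod (u1 x))\<^sup>2 + a\<^sup>2 * (cmod (u0 x))\<^sup>2" for x
  have e_nonneg: "e x \<ge> 0" for x by (simp add: e_def)
  define n where "n x = (cmod (u2 x))\<^sup>2 + 2 * a\<^sup>2 * (cmod (u1 x))\<^sup>2 + a ^ 4 * (cmod (u0 x))\<^sup>2" for x
  have sq: "of_real ((cmod z)\<^sup>2) = z * cnj z" for z by (rule complex_norm_square)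
  have PV1: "primitive (\<lambda>x. of_real (V2 x)) (\<lambda>x. of_real (V1 x))"
    using V1 V2 by (intro primitiveI_C1 has_vector_derivative_of_real continuous_on_of_real)
      (auto simp: has_real_derivative_iff_has_vector_derivative)
  have cV: "continuous_on {0..} V" and cV1: "continuous_on {0..} V1"
    using V V1 by (auto intro: DERIV_continuous_on)
  have PV: "primitive (\<lambda>x. of_real (V1 x)) (\<lambda>x. of_real (V x))"
    using V cV1 by (intro primitiveI_C1 has_vector_derivative_of_real continuous_on_of_real)
      (auto simp: has_real_derivative_iff_has_vector_derivative)
  note m = borel_measurable_halfline_continuous[OF cV] borel_measurable_halfline_continuous[OF cV1]
    borel_measurable_halfline_continuous[OF V2]
  have Vb': "\<bar>V x\<bar> \<le> max \<bar>Vmin\<bar> \<bar>Vmax\<bar>" if "x \<ge> 0" for x using Vb[OF that] by linarith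
  have V2b': "\<bar>V2 x\<bar> \<le> max \<bar>V2min\<bar> \<bar>V2max\<bar>" if "x \<ge> 0" for x using V2b[OF that] by linarith
  have iV: "integrable halfline (\<lambda>x. of_real (V x) * f x)" if "integrable halfline f" for f :: "real \<Rightarrow> complex"
    by (rule integrable_bounded_mult[OF m(1)], erule Vb', rule that)
  have iV1: "integrable halfline (\<lambda>x. of_real (V1 x) * f x)" if "integrable halfline f" for f :: "real \<Rightarrow> complex"
    by (rule integrable_bounded_mult[OF m(2)], erule V1b, rule that)
  have iV2: "integrable halfline (\<lambda>x. of_real (V2 x) * f x)" if "integrable halfline f" for f :: "real \<Rightarrow> complex"
    by (rule integrable_bounded_mult[OF m(3)], erule V2b', rule that)
  note iL = L2_integrable_mult_cnj

  \<comment> \<open>Each of \<open>j1\<close>, ..., \<open>j4\<close> is an exact derivative with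
    zero integral. Once this is known, all integrations by parts reduce to one pointwise algebraic
    identity.\<close>
  define j1 where "j1 x = u4 x * cnj (u0 x) - u2 x * cnj (u2 x)" for x
  define j2 where "j2 x = u2 x * cnj (u0 x) + u1 x * cnj (u1 x)" for x
  define j3 where "j3 x = of_real (V1 x) * (u1 x * cnj (u0 x))
      + of_real (V x) * (u2 x * cnj (u0 x) + u1 x * cnj (u1 x))" for x
  define j4 where "j4 x = of_real (V2 x) * (u0 x * cnj (u0 x))
      + of_real (V1 x) * (u1 x * cnj (u0 x) + u0 x * cnj (u1 x))" for x
  have i1: "integrable halfline j1" and i2: "integrable halfline j2"
    unfolding j1_def[abs_def] j2_def[abs_def]
    using L by (auto intro!: iL Bochner_Integration.integrable_add Bochner_Integration.integrable_diff)
  have i3: "integrable halfline j3"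
    unfolding j3_def[abs_def]
    by (intro Bochner_Integration.integrable_add iL iV iV1 L)
  have i4: "integrable halfline j4"
    unfolding j4_def[abs_def]
    by (intro Bochner_Integration.integrable_add iL iV1 iV2 L)

  \<comment> \<open>Both boundary conditions act here: \<open>u0 0 = 0\<close> removes the first
    product and \<open>u1 0 = 0\<close> the second. The boundary values of the other three
    primitives all contain the factor \<open>u0 0\<close>.\<close>
  have "primitive j1 (\<lambda>x. u3 x * cnj (u0 x) - u2 x * cnj (u1 x))"
    using primitive_diff[OF primitive_mult[OF P3 primitive_cnj[OF P0]] primitive_mult[OF P2 primitive_cnj[OF P1]]]
    by (simp add: j1_def[abs_def])
  from integral_primitive[OF this i1] have z1: "integral\<^sup>L halfline j1 = 0"
    using L bc by (simp add: iL Bochner_Integration.integrable_diff)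
  have "primitive j2 (\<lambda>x. u1 x * cnj (u0 x))"
    using primitive_mult[OF P1 primitive_cnj[OF P0]] by (simp add: j2_def[abs_def])
  from integral_primitive[OF this i2] have z2: "integral\<^sup>L halfline j2 = 0"
    using L bc by (simp add: iL Bochner_Integration.integrable_diff)
  have "primitive j3 (\<lambda>x. of_real (V x) * (u1 x * cnj (u0 x)))"
    using primitive_mult[OF PV primitive_mult[OF P1 primitive_cnj[OF P0]]] by (simp add: j3_def[abs_def])
  from integral_primitive[OF this i3] have z3: "integral\<^sup>L halfline j3 = 0"
    using L bc by (simp add: iL Bochner_Integration.integrable_diff iV)
  have "primitive j4 (\<lambda>x. of_real (V1 x) * (u0 x * cnj (u0 x)))"
    using primitive_mult[OF PV1 primitive_mult[OF P0 primitive_cnj[OF P0]]] by (simp add: j4_def[abs_def])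
  from integral_primitive[OF this i4] have z4: "integral\<^sup>L halfline j4 = 0"
    using L bc by (simp add: iL Bochner_Integration.integrable_diff iV1)

  have ie: "integrable halfline e" and "in": "integrable halfline n"
    unfolding e_def[abs_def] n_def[abs_def]
    using L by (auto intro!: Bochner_Integration.integrable_add integrable_mult_right L2_norm_sq_integrable)
  have iVe: "integrable halfline (\<lambda>x. V x * e x)"
    using integrable_Re[OF iV[OF integrable_of_real[OF ie]]] by simp
  define t where "t x = of_real (V1 x) * (u0 x * cnj (u1 x))" for x
  have it: "integrable halfline t" unfolding t_def[abs_def] by (intro iV1 iL L)

  define E where "E = integral\<^sup>L halfline e"
  define N where "N = integral\<^sup>L halfline n"
  define Q where "Q = (LINT x|halfline. V x * e x)"
  define T where "T = integral\<^sup>L halfline t"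

  have "E > 0"
  proof -
    have "E \<ge> 0" unfolding E_def by (rule integral_nonneg_AE) (auto simp: e_def)
    moreover have "E \<noteq> 0"
    proof
      assume "E = 0"
      then have "AE x in halfline. e x = 0"
        unfolding E_def by (subst (asm) integral_nonneg_eq_0_iff_AE[OF ie]) (auto simp: e_def)
      then have "AE x in halfline. u0 x = 0"
        by eventually_elim (use a in \<open>auto simp: e_def add_nonneg_eq_0_iff\<close>)
      then show False using nz by blast
    qed
    ultimately show ?thesis by simp
  qed
  have "a\<^sup>2 * E \<le> N"
  proof -
    have "a\<^sup>2 * E = (LINT x|halfline. a\<^sup>2 * e x)" by (simp add: E_def)
    also have "\<dots> \<le> N" unfolding N_def
    proof (rule integral_mono)
      show "a\<^sup>2 * e x \<le> n x" for x
      proof -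
        have "n x = a\<^sup>2 * e x + ((cmod (u2 x))\<^sup>2 + a\<^sup>2 * (cmod (u1 x))\<^sup>2)"
          by (simp add: e_def n_def algebra_simps power2_eq_square power4_eq_xxxx)
        then show ?thesis by simp
      qed
    qed (use ie "in" in auto)
    finally show ?thesis .
  qed
  have Ql: "Vmin * E \<le> Q"
  proof -
    have "Vmin * E = (LINT x|halfline. Vmin * e x)" by (simp add: E_def)
    also have "\<dots> \<le> Q" unfolding Q_def
      by (rule integral_mono) (use ie iVe Vb e_nonneg in \<open>auto intro!: mult_right_mono\<close>)
    finally show ?thesis .
  qed
  have Qu: "Q \<le> Vmax * E"
  proof -
    have "Q \<le> (LINT x|halfline. Vmax * e x)" unfolding Q_def
      by (rule integral_mono) (use ie iVe Vb e_nonneg in \<open>auto intro!: mult_right_mono\<close>)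
    then show ?thesis by (simp add: E_def)
  qed
  \<comment> \<open>The weight \<open>a\<close> is attached to \<open>u0\<close>, so that the mean
    inequality for \<open>a * cmod (u0 x)\<close> and \<open>cmod (u1 x)\<close> yields exactly the
    density \<open>e x\<close>.\<close>
  have Tb: "a * cmod T \<le> V1max / 2 * E"
  proof -
    have "a * cmod T \<le> a * (LINT x|halfline. norm (t x))"
      unfolding T_def using a by (intro mult_left_mono integral_norm_bound) auto
    also have "\<dots> = (LINT x|halfline. a * norm (t x))" by simp
    also have "\<dots> \<le> (LINT x|halfline. V1max / 2 * e x)"
    proof (rule integral_mono)
      fix x assume "x \<in> space halfline"
      then have x: "x \<ge> 0" by simp
      have "2 * (a * cmod (u0 x)) * cmod (u1 x) \<le> e x"
        using sum_squares_bound[of "a * cmod (u0 x)" "cmod (u1 x)"] by (simp add: e_def power_mult_distrib)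
      moreover have "V1max \<ge> 0" using V1b[OF x] by linarith
      ultimately have "\<bar>V1 x\<bar> * (2 * (a * cmod (u0 x)) * cmod (u1 x)) \<le> V1max * e x"
        using V1b[OF x] a by (intro mult_mono) auto
      then show "a * norm (t x) \<le> V1max / 2 * e x" by (simp add: t_def norm_mult mult_ac)
    qed (use ie it in auto)
    finally show ?thesis by (simp add: E_def)
  qed

  have main: "\<mu> * of_real E = of_real N + \<i> * of_real (a * R) * (of_real Q - T)"
  proof -
    \<comment> \<open>The equation multiplied by \<open>cnj (u0 x)\<close>. In
      \<open>j4 - j3\<close> the two terms \<open>V1 u1 cnj u0\<close> cancel, so
      \<open>V2 u0 cnj u0 - V u2 cnj u0\<close> equals \<open>V u1 cnj u1 - V1 u0 cnj u1\<close> up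
      to an exact derivative: a single term with \<open>V1\<close> survives.\<close>
    have "AE x in halfline. \<mu> * of_real (e x) = of_real (n x) + \<i> * of_real (a * R) * (of_real (V x * e x) - t x)
        + (j1 x - (2 * of_real (a\<^sup>2)) * j2 x + \<i> * of_real (a * R) * (j4 x - j3 x) + \<mu> * j2 x)"
      using eq
    proof eventually_elim
      case (elim x)
      have "\<mu> * of_real (e x) - \<mu> * j2 x = (\<mu> * (of_real (a\<^sup>2) * u0 x - u2 x)) * cnj (u0 x)"
        unfolding e_def j2_def of_real_add of_real_mult sq by (simp add: algebra_simps)
      also have "\<dots> = of_real (n x) + \<i> * of_real (a * R) * (of_real (V x * e x) - t x)
        + (j1 x - (2 * of_real (a\<^sup>2)) * j2 x + \<i> * of_real (a * R) * (j4 x - j3 x))"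
        unfolding elim[symmetric] n_def e_def t_def j1_def j2_def j3_def j4_def of_real_add of_real_mult sq
        by (simp add: algebra_simps)
      finally show ?case by (simp add: algebra_simps)
    qed
    moreover have [measurable]: "V \<in> borel_measurable halfline" "e \<in> borel_measurable halfline"
      "n \<in> borel_measurable halfline" "t \<in> borel_measurable halfline" "j1 \<in> borel_measurable halfline"
      "j2 \<in> borel_measurable halfline" "j3 \<in> borel_measurable halfline" "j4 \<in> borel_measurable halfline"
      using m(1) ie "in" it i1 i2 i3 i4 by auto
    ultimately have "(LINT x|halfline. \<mu> * of_real (e x)) =
      (LINT x|halfline. of_real (n x) + \<i> * of_real (a * R) * (of_real (V x * e x) - t x)
        + (j1 x - (2 * of_real (a\<^sup>2)) * j2 x + \<i> * of_real (a * R) * (j4 x - j3 x) + \<mu> * j2 x))"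
      by (intro integral_cong_AE) measurable
    also have "\<dots> = of_real N + \<i> * of_real (a * R) * (of_real Q - T)"
    proof -
      have iVe': "integrable halfline (\<lambda>x. complex_of_real (V x * e x))"
        by (rule integrable_of_real[OF iVe])
      have "(LINT x|halfline. \<i> * of_real (a * R) * (of_real (V x * e x) - t x))
          = \<i> * of_real (a * R) * (of_real Q - T)"
        using iVe' it by (simp add: Q_def T_def del: of_real_mult)
      moreover have "(LINT x|halfline. j1 x - (2 * of_real (a\<^sup>2)) * j2 x
          + \<i> * of_real (a * R) * (j4 x - j3 x) + \<mu> * j2 x) = 0"
        using i1 i2 i3 i4 by (simp add: z1 z2 z3 z4)
      ultimately show ?thesis
        using iVe' it i1 i2 i3 i4 "in" by (simp add: N_def del: of_real_mult)
    qed
    finally show ?thesis by (simp add: E_def)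
  qed
  define d where "d = - \<i> * of_real (a * R) * T / of_real E"
  have "\<mu> = of_real (N / E) + \<i> * of_real (a * R) * of_real (Q / E) + d"
  proof -
    have "\<mu> = (of_real N + \<i> * of_real (a * R) * (of_real Q - T)) / of_real E"
      using main \<open>E > 0\<close> by (simp add: eq_divide_eq)
    then show ?thesis
      by (simp add: d_def add_divide_distrib diff_divide_distrib right_diff_distrib)
  qed
  moreover have "a\<^sup>2 \<le> N / E" using \<open>a\<^sup>2 * E \<le> N\<close> \<open>E > 0\<close> by (simp add: field_simps)
  moreover have "Q / E \<in> {Vmin..Vmax}" using Ql Qu \<open>E > 0\<close> by (simp add: field_simps)
  moreover have "d \<in> complex_of_real (R / 2 * V1max) *o cball 0 1"
  proof -
    define r where "r = R / 2 * V1max"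
    have "cmod d = R * (a * cmod T) / E"
      using a R \<open>E > 0\<close> by (simp add: d_def norm_mult norm_divide)
    also have "\<dots> \<le> R * (V1max / 2 * E) / E"
      using Tb R \<open>E > 0\<close> by (intro divide_right_mono mult_left_mono) auto
    also have "\<dots> = r" using \<open>E > 0\<close> by (simp add: r_def)
    finally have d: "cmod d \<le> r" .
    \<comment> \<open>If \<open>r = 0\<close> then the bound forces \<open>d = 0\<close>, and the
      quotient is 0 by convention, so the degenerate disc needs no separate witness.\<close>
    have "d = of_real r * (d / of_real r)" using d by auto
    moreover have "d / of_real r \<in> cball 0 1"
      using d norm_ge_zero[of d] by (cases "r = 0") (auto simp: norm_divide divide_simps)
    ultimately show ?thesis unfolding r_def[symmetric] elt_set_times_def by blast
  qed
  ultimately show ?thesis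
    unfolding set_plus_def elt_set_times_def by blast
qed

theorem theorem3p1:
  fixes a R Vmin Vmax V1max V2min V2max :: real
    and V V1 V2 :: "real \<Rightarrow> real"
    and \<mu> :: complex
  assumes "a > 0" and "R > 0"
    and "\<And>x. x \<ge> 0 \<Longrightarrow> (V has_real_derivative V1 x) (at x within {0..})"
    and "\<And>x. x \<ge> 0 \<Longrightarrow> (V1 has_real_derivative V2 x) (at x within {0..})"
    and "continuous_on {0..} V2"
    and "\<And>x. x \<ge> 0 \<Longrightarrow> Vmin \<le> V x \<and> V x \<le> Vmax"
    and "\<And>x. x \<ge> 0 \<Longrightarrow> \<bar>V1 x\<bar> \<le> V1max"
    and "\<And>x. x \<ge> 0 \<Longrightarrow> V2min \<le> V2 x \<and> V2 x \<le> V2max"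
    and "is_eigenvalue dom_A (op_A a R V V2) (op_B a) \<mu>"
  shows "\<mu> \<in> complex_of_real ` {a\<^sup>2..}
              + (\<i> * of_real (a * R)) *o (complex_of_real ` {Vmin..Vmax})
              + complex_of_real (R / 2 * V1max) *o cball 0 1"
proof -
  obtain u where u: "u \<in> dom_A" and nz: "\<not> ae_eq u (\<lambda>x. 0)"
    and ev: "ae_eq (op_A a R V V2 u) (\<lambda>x. \<mu> * op_B a u x)"
    using assms(9) by (auto simp: is_eigenvalue_def)
  have H4: "u \<in> sobolev_H 4" and tr: "has_trace u 0" "has_trace (weak_deriv 1 u) 0"
    using u by (auto simp: dom_A_def H2_0_def)
  note w = weak_deriv_L2[OF H4]
  define w4 where "w4 = weak_deriv 4 u"
  have w4: "has_weak_deriv 4 u w4" "w4 \<in> L2" using w[of 4] by (auto simp: w4_def)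
  \<comment> \<open>The descent starts from the fourth derivative, the only one for which no
    continuous representative is sought.\<close>
  obtain u3 where u3: "primitive w4 u3" "AE x in halfline. weak_deriv 3 u x = u3 x" "u3 \<in> L2"
    using sobolev_primitive[OF H4, of 3 w4] w4 L2_measurable by (auto simp: w4_def)
  obtain u2 where u2: "primitive u3 u2" "AE x in halfline. weak_deriv 2 u x = u2 x" "u2 \<in> L2"
    using sobolev_primitive[OF H4, of 2 u3] u3 L2_measurable by (auto simp: eval_nat_numeral)
  obtain u1 where u1: "primitive u2 u1" "AE x in halfline. weak_deriv 1 u x = u1 x" "u1 \<in> L2"
    using sobolev_primitive[OF H4, of 1 u2] u2 L2_measurable by (auto simp: eval_nat_numeral)
  obtain u0 where u0: "primitive u1 u0" "AE x in halfline. weak_deriv 0 u x = u0 x" "u0 \<in> L2"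
    using sobolev_primitive[OF H4, of 0 u1] u1 L2_measurable by auto
  \<comment> \<open>Even \<open>weak_deriv 0 u\<close> is a selected function; uniqueness at order 0
    identifies it with \<open>u\<close>.\<close>
  have u_eq: "AE x in halfline. u x = u0 x"
    using has_weak_deriv_unique[OF has_weak_deriv_self[OF H4] w(1)[of 0]] u0(2) by auto
  have bc: "u0 0 = 0" "u1 0 = 0"
    using trace_eq_value[OF tr(1) primitive_continuous_on[OF u0(1)] u_eq]
      trace_eq_value[OF tr(2) primitive_continuous_on[OF u1(1)] u1(2)] .
  have B: "op_B a u = (\<lambda>x. of_real (a\<^sup>2) * u x + (- 1) * weak_deriv 2 u x)"
    by (simp add: op_B_def fun_eq_iff)
  \<comment> \<open>An explicit second weak derivative of \<open>op_B a u\<close> is needed to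
    identify the one selected inside \<open>op_A\<close>. It is computed first for the negative of
    \<open>op_B a u\<close>, which has the shape of a linear combination with leading coefficient
    1.\<close>
  have "has_weak_deriv 2 (\<lambda>x. weak_deriv 2 u x + (- of_real (a\<^sup>2)) * u x)
      (\<lambda>x. w4 x + (- of_real (a\<^sup>2)) * weak_deriv 2 u x)"
    using w(1)[of 2] w4 by (intro has_weak_deriv_lincomb has_weak_deriv_diff[OF w(1)[of 2]]) auto
  \<comment> \<open>Combining a function \<open>h\<close> with itself as
    \<open>h + (- 2) * h\<close> negates it.\<close>
  from has_weak_deriv_lincomb[OF this this, of "- 2"]
  have "has_weak_deriv 2 (op_B a u) (\<lambda>x. of_real (a\<^sup>2) * weak_deriv 2 u x - w4 x)"
    by (simp add: B algebra_simps)
  from has_weak_deriv_unique[OF has_weak_deriv_weak_deriv[OF this] this]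
  have BB: "AE x in halfline. weak_deriv 2 (op_B a u) x = of_real (a\<^sup>2) * weak_deriv 2 u x - w4 x" .
  have "AE x in halfline. w4 x - 2 * of_real (a\<^sup>2) * u2 x + of_real (a ^ 4) * u0 x
        + \<i> * of_real (a * R) * (of_real (V x) * (of_real (a\<^sup>2) * u0 x - u2 x) + of_real (V2 x) * u0 x)
      = \<mu> * (of_real (a\<^sup>2) * u0 x - u2 x)"
    using ev[unfolded ae_eq_def] BB u_eq u2(2)
  proof eventually_elim
    case (elim x)
    have Bx: "op_B a u x = of_real (a\<^sup>2) * u0 x - u2 x" using elim by (simp add: op_B_def)
    have "op_B a (op_B a u) x = - weak_deriv 2 (op_B a u) x + of_real (a\<^sup>2) * op_B a u x"
      by (simp add: op_B_def)
    then have "op_B a (op_B a u) x = w4 x - 2 * of_real (a\<^sup>2) * u2 x + of_real (a ^ 4) * u0 x"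
      unfolding Bx elim by (simp add: algebra_simps power2_eq_square power4_eq_xxxx)
    then show ?case using elim(1) by (simp add: op_A_def Bx elim(3))
  qed
  moreover have "\<not> (AE x in halfline. u0 x = 0)"
  proof
    assume "AE x in halfline. u0 x = 0"
    with u_eq have "AE x in halfline. u x = 0" by eventually_elim simp
    then show False using nz by (simp add: ae_eq_def)
  qed
  ultimately show ?thesis
    using numerical_range_inclusion[OF assms(1-8) u0(1) u1(1) u2(1) u3(1) u0(3) u1(3) u2(3) u3(3) w4(2) bc]
    by blast
qed

end
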